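(* Let $V\in\mathbb{R}^{n\times n}$ be symmetric positive definite, let $S\in\mathbb{R}^{n\times n}$ be skew-symmetric, and let $B:=-(I+S)V^{-1}$. Define constants $0<C_1\le C_2$ by $$C_1=\|V^{-1/2}(I+S)V^{-1}(I-S)V^{1/2}\|,\qquad C_2=\|V^{-1/2}(I+S)V^{-1/2}\|^2\,\|V\|.$$ Suppose $c>0$, $h>0$ and $\sigma>0$ satisfy $$h<\frac{2}{C_2},\qquad \sigma^2\le\frac{2-hC_2}{2-h(C_2-C_1)},\qquad c\le\sigma^n.$$ Let $\pi$ be the density of $N(0,V)$, let $q(x,\cdot)$ be the density of $N((I+hB)x,\,2h\sigma^2 I)$, let $\rho$ be the density of $N(0,R)$ with $R$ the unique positive definite solution of $R=2h\sigma^2 I+(I+hB)R(I+hB')$, and put $\gamma(x,y):=\rho(x)q(x,y)-\rho(y)q(y,x)$. Then $\widetilde\gamma(x,y):=c\,\gamma(x,y)$ satisfies $$\widetilde\gamma(x,y)+\pi(y)q(y,x)\ge 0\quad\text{for all }x,y\in\mathbb{R}^n,$$ and is therefore a vorticity density compatible with the proposal distribution $Q(x,dy)\sim N((I+hB)x,2h\sigma^2I)$ and the invariant distribution $N(0,V)$.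
   Context: $\|\cdot\|$ is the Euclidean norm on $\mathbb{R}^n$ and its induced matrix norm; $A'$ denotes the transpose of $A$; $N(m,\Sigma)$ is the normal distribution with mean $m$ and covariance $\Sigma$. The matrix $R$ is well defined because the spectral radius of $I+hB$ is less than $1$ when $0<h<2/C_2$; $\rho$ is then the invariant density of $Q$. A measurable function $\widetilde\gamma:\mathbb{R}^n\times\mathbb{R}^n\to\mathbb{R}$ is a vorticity density compatible with a proposal kernel $Q(x,dy)=q(x,y)\,dy$ and a target density $\pi$ if: $\widetilde\gamma(x,y)=-\widetilde\gamma(y,x)$ for all $x,y$; $\int_{A\times\mathbb{R}^n}\widetilde\gamma(x,y)\,dx\,dy=0$ for all Borel $A\subset\mathbb{R}^n$; $\widetilde\gamma(x,y)=0$ whenever $\pi(x)q(x,y)=0$; $\pi(x)q(x,y)=0$ if and only if $\pi(y)q(y,x)=0$; and $\widetilde\gamma(x,y)+\pi(y)q(y,x)\ge 0$ whenever $\pi(x)q(x,y)\ne0$. (Here $\pi$ and $q$ are strictly positive everywhere.) *)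

theory Defs
  imports "HOL-Analysis.Analysis"
begin

definition pos_def :: "real^'n^'n \<Rightarrow> bool" where
  "pos_def A \<longleftrightarrow> transpose A = A \<and> (\<forall>x. x \<noteq> 0 \<longrightarrow> x \<bullet> (A *v x) > 0)"

definition matrix_sqrt :: "real^'n^'n \<Rightarrow> real^'n^'n" where
  "matrix_sqrt A = (THE W. pos_def W \<and> W ** W = A)"

definition matrix_norm :: "real^'n^'n \<Rightarrow> real" where
  "matrix_norm A = onorm (\<lambda>x. A *v x)"

text \<open>Lebesgue density of $N(m,\Sigma)$ at $x$, for a positive definite covariance matrix.\<close>

definition mv_normal_density :: "real^'n \<Rightarrow> real^'n^'n \<Rightarrow> real^'n \<Rightarrow> real" where
  "mv_normal_density m \<Sigma> x =
     exp (- ((x - m) \<bullet> (matrix_inv \<Sigma> *v (x - m))) / 2) / sqrt ((2 * pi) ^ CARD('n) * det \<Sigma>)"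

text \<open>
  Here \<open>q\<close> is the density of the proposal kernel $Q(x,dy) = q(x,y)\,dy$ and \<open>p\<close> the target density.
  Integrability is required explicitly because the Bochner integral of a non-integrable
  function is 0 by convention.
\<close>

definition vorticity_density ::
  "(real^'n \<Rightarrow> real^'n \<Rightarrow> real) \<Rightarrow> (real^'n \<Rightarrow> real) \<Rightarrow> (real^'n \<Rightarrow> real^'n \<Rightarrow> real) \<Rightarrow> bool" where
  "vorticity_density q p g \<longleftrightarrow>
     (\<lambda>(x, y). g x y) \<in> borel_measurable borel \<and>
     (\<forall>x y. g x y = - g y x) \<and>
     (\<forall>A \<in> sets borel.
        set_integrable lborel (A \<times> UNIV) (\<lambda>(x, y). g x y) \<and>
        set_lebesgue_integral lborel (A \<times> UNIV) (\<lambda>(x, y). g x y) = 0) \<and>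
     (\<forall>x y. p x * q x y = 0 \<longrightarrow> g x y = 0) \<and>
     (\<forall>x y. p x * q x y = 0 \<longleftrightarrow> p y * q y x = 0) \<and>
     (\<forall>x y. p x * q x y \<noteq> 0 \<longrightarrow> g x y + p y * q y x \<ge> 0)"

end

theory Submission
  imports Defs "HOL-Probability.Distributions"
begin

text \<open>
  Write \<open>A = I + h B\<close>, so that \<open>Q(x, \<cdot>) = N(A x, 2 h \<sigma>\<^sup>2 I)\<close>. Since
  \<open>c \<gamma>(x, y) + \<pi>(y) q(y, x) = c \<rho>(x) q(x, y) + (\<pi>(y) - c \<rho>(y)) q(y, x)\<close>, positivity follows from the
  pointwise domination \<open>c \<rho> \<le> \<pi>\<close> of one Gaussian density by another. This holds as soon as
  \<open>\<sigma>\<^sup>2 V \<le> R \<le> V\<close> in the order of quadratic forms: the upper bound compares the exponents, and the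
  lower bound gives \<open>det R \<ge> \<sigma>\<^sup>2\<^sup>n det V\<close>, which with \<open>c \<le> \<sigma>\<^sup>n\<close> compares the normalizing constants
  (lemma \<open>normal_density_domination\<close>).

  The two matrix bounds come from the Lyapunov equation \<open>R = 2 h \<sigma>\<^sup>2 I + A R A'\<close> and the identity
  \<open>A V A' = V - 2 h I + h\<^sup>2 T\<close> with \<open>T = (I + S) V\<^sup>-\<^sup>1 (I - S)\<close>, in which skewness of \<open>S\<close> has removed
  \<open>S\<close> from the first order term. The constants enter through \<open>T \<le> C1 I\<close> and \<open>C1 \<le> C2\<close>: the condition
  \<open>h C2 < 2\<close> makes \<open>A V A' < V\<close>, so the Lyapunov operator \<open>X \<mapsto> X - A X A'\<close> is invertible on symmetric
  matrices and its inverse preserves nonnegativity (\<open>Lyapunov_nonneg\<close>, \<open>Lyapunov_ex1\<close>); the operator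
  sends \<open>R - \<sigma>\<^sup>2 V\<close> and \<open>V - R\<close> to nonnegative matrices, the second by the condition on \<open>\<sigma>\<close>
  (\<open>stationary_covariance_bounds\<close>).

  The remaining properties of a vorticity density hold for the flux of any integrable invariant
  density (\<open>invariant_flux\<close>). That \<open>\<rho>\<close> is invariant under \<open>Q\<close> is a completed square together with a
  comparison of total masses (\<open>normal_invariant\<close>).

  The bound \<open>T \<le> C1 I\<close> holds because the maximum of the Rayleigh quotient of \<open>T\<close> is an eigenvalue of
  every matrix similar to \<open>T\<close>. The same maximization yields an orthonormal eigenbasis of a symmetric
  matrix, hence existence and uniqueness of the square root of \<open>V\<close> and monotonicity of the
  determinant.
\<close>

section \<open>Positive definite matrices and the Loewner order\<close>

lemma inner_matrix_vector_transpose: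
  fixes A :: "real^'n^'m"
  shows "x \<bullet> (A *v y) = (transpose A *v x) \<bullet> y"
  by (simp add: dot_lmul_matrix)

lemma inner_matrix_vector_sym:
  fixes A :: "real^'n^'n"
  assumes "transpose A = A"
  shows "x \<bullet> (A *v y) = y \<bullet> (A *v x)"
  by (metis assms inner_commute inner_matrix_vector_transpose)

lemma matrix_inv_cancel:
  fixes A :: "real^'n^'n"
  assumes "invertible A"
  shows "A ** matrix_inv A = mat 1" "matrix_inv A ** A = mat 1"
proof -
  have "\<exists>B. A ** B = mat 1 \<and> B ** A = mat 1" using assms unfolding invertible_def .
  from someI_ex[OF this] show "A ** matrix_inv A = mat 1" "matrix_inv A ** A = mat 1"
    by (auto simp: matrix_inv_def)
qed

lemma matrix_inv_unique:
  fixes A :: "real^'n^'n"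
  assumes "A ** B = mat 1"
  shows "matrix_inv A = B"
  by (metis assms invertible_right_inverse matrix_inv_cancel(2) matrix_mul_assoc matrix_mul_lid matrix_mul_rid)

lemma pos_defD:
  assumes "pos_def A"
  shows "transpose A = A" "x \<noteq> 0 \<Longrightarrow> 0 < x \<bullet> (A *v x)" "0 \<le> x \<bullet> (A *v x)"
  using assms by (cases "x = 0"; auto simp: pos_def_def less_imp_le)+

lemma pos_def_invertible:
  assumes "pos_def A"
  shows "invertible A"
  unfolding invertible_left_inverse matrix_left_invertible_ker
  using pos_defD(2)[OF assms] by force

lemmas pos_def_inv_cancel = matrix_inv_cancel[OF pos_def_invertible]

lemma pos_def_inv_cancel_vec:
  assumes "pos_def A"
  shows "A *v (matrix_inv A *v x) = x" "matrix_inv A *v (A *v x) = x"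
  by (simp_all add: matrix_vector_mul_assoc pos_def_inv_cancel[OF assms])

lemma pos_def_matrix_inv:
  assumes "pos_def A"
  shows "pos_def (matrix_inv A)"
  unfolding pos_def_def
proof (intro conjI allI impI)
  show "transpose (matrix_inv A) = matrix_inv A"
    by (metis assms matrix_inv_unique matrix_transpose_mul pos_defD(1) pos_def_inv_cancel(2) transpose_mat)
  fix x :: "real^'a" assume "x \<noteq> 0"
  then have "matrix_inv A *v x \<noteq> 0"
    by (metis assms matrix_vector_mult_0_right pos_def_inv_cancel_vec(1))
  from pos_defD(2)[OF assms this] show "0 < x \<bullet> (matrix_inv A *v x)"
    by (simp add: pos_def_inv_cancel_vec[OF assms] inner_commute)
qed

lemma pos_def_scaled_identity: "0 < s \<Longrightarrow> pos_def (s *\<^sub>R mat 1 :: real^'n^'n)"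
  by (auto simp: pos_def_def transpose_scalar scaleR_matrix_vector_assoc[symmetric])

lemma matrix_inv_scaled_identity:
  "s \<noteq> 0 \<Longrightarrow> matrix_inv (s *\<^sub>R mat 1 :: real^'n^'n) = (1 / s) *\<^sub>R mat 1"
  by (intro matrix_inv_unique)
     (metis matrix_scalar_ac matrix_mul_lid nonzero_mult_div_cancel_left scaleR_scaleR times_divide_eq_right mult.right_neutral scalar_matrix_assoc scaleR_one)

text \<open>
  Inversion reverses the order because \<open>x \<bullet> A\<^sup>-\<^sup>1 x\<close> is the maximum of \<open>2 (x \<bullet> z) - z \<bullet> A z\<close> over
  \<open>z\<close>; it suffices to insert \<open>z = B\<^sup>-\<^sup>1 x\<close>. Nonnegativity of \<open>A\<close> at \<open>A\<^sup>-\<^sup>1 x - B\<^sup>-\<^sup>1 x\<close> is that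
  inequality.
\<close>

lemma matrix_inv_antimono:
  assumes A: "pos_def A" and B: "pos_def B" and le: "\<And>x. x \<bullet> (A *v x) \<le> x \<bullet> (B *v x)"
  shows "x \<bullet> (matrix_inv B *v x) \<le> x \<bullet> (matrix_inv A *v x)"
proof -
  define y where "y = matrix_inv A *v x"
  define z where "z = matrix_inv B *v x"
  have x: "A *v y = x" "B *v z = x"
    by (simp_all add: y_def z_def pos_def_inv_cancel_vec A B)
  have "0 \<le> (y - z) \<bullet> (A *v (y - z))" by (rule pos_defD(3)[OF A])
  also have "\<dots> = y \<bullet> x - 2 * (z \<bullet> x) + z \<bullet> (A *v z)"
    using inner_matrix_vector_sym[OF pos_defD(1)[OF A], of y z]
    by (simp add: matrix_vector_mult_diff_distrib x inner_diff_left inner_diff_right)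
  also have "z \<bullet> (A *v z) \<le> z \<bullet> x" using le[of z] by (simp add: x)
  finally show ?thesis by (simp add: y_def z_def inner_commute)
qed


section \<open>Spectral theorem\<close>

text \<open>
  The quadratic form attains its maximum \<open>l\<close> on the unit sphere of \<open>T\<close>, and a maximizer is an
  eigenvector: otherwise moving against the residual \<open>l x - A x\<close>, which stays in \<open>T\<close>, would make
  \<open>l (y \<bullet> y) - y \<bullet> A y\<close> negative to first order.
\<close>

lemma Rayleigh_maximizer:
  fixes A :: "real^'n^'n"
  assumes sym: "transpose A = A" and T: "subspace T" "T \<noteq> {0}"
    and inv: "\<And>x. x \<in> T \<Longrightarrow> A *v x \<in> T"
  obtains l x where "x \<in> T" "norm x = 1" "A *v x = l *\<^sub>R x"
    and "\<And>y. y \<in> T \<Longrightarrow> y \<bullet> (A *v y) \<le> l * (y \<bullet> y)"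
proof -
  let ?K = "T \<inter> sphere 0 1"
  have cont: "continuous_on ?K (\<lambda>x. x \<bullet> (A *v x))"
    by (intro continuous_intros linear_continuous_on matrix_vector_mul_bounded_linear)
  have comp: "compact ?K"
    by (intro closed_Int_compact closed_subspace T) auto
  obtain w where w: "w \<in> T" "w \<noteq> 0" using T subspace_0 by blast
  then have "w /\<^sub>R norm w \<in> ?K" using subspace_scale[OF T(1)] by simp
  then have "?K \<noteq> {}" by blast
  from continuous_attains_sup[OF comp this cont] obtain x
    where x: "x \<in> T" "norm x = 1" and mx: "\<And>y. y \<in> ?K \<Longrightarrow> y \<bullet> (A *v y) \<le> x \<bullet> (A *v x)"
    by auto
  define l where "l = x \<bullet> (A *v x)"
  have max: "y \<bullet> (A *v y) \<le> l * (y \<bullet> y)" if y: "y \<in> T" for y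
  proof (cases "y = 0")
    case False
    then have "y /\<^sub>R norm y \<in> ?K" using subspace_scale[OF T(1)] y by simp
    from mx[OF this] have "(y \<bullet> (A *v y)) / (norm y)^2 \<le> l"
      by (simp add: l_def matrix_vector_mult_scaleR power2_eq_square divide_inverse mult_ac)
    then show ?thesis using False
      by (simp add: divide_le_eq power2_norm_eq_inner split: if_splits)
  qed simp
  have xx: "x \<bullet> x = 1" using x by (simp add: dot_square_norm)
  define z where "z = l *\<^sub>R x - A *v x"
  have zT: "z \<in> T" unfolding z_def using x inv T by (intro subspace_diff subspace_scale) auto
  define g where "g = l * (z \<bullet> z) - z \<bullet> (A *v z)"
  have g0: "g \<ge> 0" using max[OF zT] by (simp add: g_def)
  have q: "2 * t * (z \<bullet> z) \<le> t^2 * g" for t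
  proof -
    have tT: "x - t *\<^sub>R z \<in> T" using x zT T by (intro subspace_diff subspace_scale) auto
    have zz: "z \<bullet> z = l * (x \<bullet> z) - z \<bullet> (A *v x)"
      by (subst (2) z_def) (simp add: inner_diff_right inner_commute)
    have "0 \<le> l * ((x - t *\<^sub>R z) \<bullet> (x - t *\<^sub>R z)) - (x - t *\<^sub>R z) \<bullet> (A *v (x - t *\<^sub>R z))"
      using max[OF tT] by simp
    also have "\<dots> = t^2 * g - 2 * t * (l * (x \<bullet> z) - z \<bullet> (A *v x))"
      using inner_matrix_vector_sym[OF sym, of x z] xx
      by (simp add: g_def l_def matrix_vector_mult_diff_distrib matrix_vector_mult_scaleR
          inner_diff_left inner_diff_right inner_commute algebra_simps power2_eq_square)
    finally show ?thesis by (simp add: zz[symmetric])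
  qed
  have "z \<bullet> z = 0"
  proof (rule ccontr)
    assume "z \<bullet> z \<noteq> 0"
    then have zp: "z \<bullet> z > 0" using inner_ge_zero[of z] by linarith
    show False
    proof (cases "g = 0")
      case True then show ?thesis using q[of 1] zp by simp
    next
      case False
      then have "g > 0" using g0 by simp
      then have "2 * ((z \<bullet> z) * (z \<bullet> z)) \<le> (z \<bullet> z) * (z \<bullet> z)"
        using q[of "(z \<bullet> z) / g"] by (simp add: power2_eq_square field_simps)
      with mult_pos_pos[OF zp zp] show False by linarith
    qed
  qed
  then have "A *v x = l *\<^sub>R x" by (simp add: z_def)
  with that x max show ?thesis by blast
qed

text \<open>
  An orthonormal family of eigenvectors of maximal cardinality spans the space: its orthogonal
  complement is invariant under the symmetric matrix, so if it were nontrivial, it would contain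
  one more eigenvector.
\<close>

lemma symmetric_eigenbasis:
  fixes A :: "real^'n^'n"
  assumes sym: "transpose A = A"
  obtains v :: "'n \<Rightarrow> real^'n" and d :: "'n \<Rightarrow> real"
  where "\<And>i j. v i \<bullet> v j = (if i = j then 1 else 0)" "\<And>i. A *v v i = d i *\<^sub>R v i"
proof -
  define E where "E B \<longleftrightarrow> pairwise orthogonal B \<and> (\<forall>b\<in>B. norm b = 1 \<and> (\<exists>l. A *v b = l *\<^sub>R b))"
    for B :: "(real^'n) set"
  have ind: "independent B" if "E B" for B
    using that by (intro pairwise_orthogonal_independent) (auto simp: E_def)
  have bound: "finite B \<and> card B \<le> CARD('n)" if "E B" for B
    using independent_bound[OF ind[OF that]] by simp
  have "E {}" by (simp add: E_def)
  then obtain B where B: "E B" and Bmax: "\<And>B'. E B' \<Longrightarrow> card B' \<le> card B"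
    using ex_has_greatest_nat[of E "{}" card "Suc CARD('n)"] bound by (auto simp: less_Suc_eq_le)
  have fin: "finite B" using bound[OF B] by simp
  define T where "T = {x. \<forall>b\<in>B. b \<bullet> x = 0}"
  have "subspace T" by (auto simp: T_def subspace_def inner_add_right)
  moreover have "A *v x \<in> T" if "x \<in> T" for x
    unfolding T_def
  proof (clarify)
    fix b assume b: "b \<in> B"
    then obtain l where l: "A *v b = l *\<^sub>R b" using B by (auto simp: E_def)
    have "b \<bullet> (A *v x) = x \<bullet> (A *v b)" by (rule inner_matrix_vector_sym[OF sym])
    also have "\<dots> = 0" using that b by (simp add: l T_def inner_commute)
    finally show "b \<bullet> (A *v x) = 0" .
  qed
  moreover have "T = {0}"
  proof (rule ccontr)
    assume "T \<noteq> {0}"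
    with Rayleigh_maximizer[OF sym \<open>subspace T\<close>] calculation
    obtain l x where x: "x \<in> T" "norm x = 1" "A *v x = l *\<^sub>R x" by metis
    have "x \<notin> B" using x by (auto simp: T_def dot_square_norm)
    have "E (insert x B)"
      using B x by (auto simp: E_def pairwise_insert T_def orthogonal_def inner_commute)
    from Bmax[OF this] show False using \<open>x \<notin> B\<close> fin by simp
  qed
  ultimately have T0: "T = {0}" by simp
  have "span B = UNIV"
  proof (rule ccontr)
    assume "span B \<noteq> UNIV"
    then obtain a where a: "a \<noteq> 0" "\<And>x. x \<in> span B \<Longrightarrow> a \<bullet> x = 0"
      using span_not_UNIV_orthogonal by metis
    then have "a \<in> T" by (simp add: T_def span_base inner_commute)
    with T0 a show False by simp
  qed
  then have "card B = CARD('n)"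
    using dim_span_eq_card_independent[OF ind[OF B]] by (simp add: dim_UNIV)
  with fin obtain v where v: "bij_betw v (UNIV :: 'n set) B"
    using finite_same_card_bij[of "UNIV :: 'n set" B] by auto
  then have vB: "v i \<in> B" for i by (auto simp: bij_betw_def)
  then have "\<exists>l. A *v v i = l *\<^sub>R v i" for i using B by (auto simp: E_def)
  then obtain d where "\<And>i. A *v v i = d i *\<^sub>R v i" by metis
  moreover have "v i \<bullet> v j = (if i = j then 1 else 0)" for i j
  proof (cases "i = j")
    case True then show ?thesis using B vB[of j] by (simp add: E_def dot_square_norm)
  next
    case False
    then have "v i \<noteq> v j" using v by (auto simp: bij_betw_def inj_def)
    then show ?thesis using False B vB by (auto simp: E_def pairwise_def orthogonal_def)
  qed
  ultimately show ?thesis using that by blast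
qed

definition diagonal_matrix :: "('n \<Rightarrow> real) \<Rightarrow> real^'n^'n" where
  "diagonal_matrix d = (\<chi> i j. if i = j then d i else 0)"

lemma diagonal_matrix_mult: "diagonal_matrix d ** diagonal_matrix e = diagonal_matrix (\<lambda>i. d i * e i)"
  by (simp add: diagonal_matrix_def matrix_matrix_mult_def vec_eq_iff if_distrib[of "\<lambda>x. x * _"] cong: if_cong)

lemma transpose_diagonal_matrix [simp]: "transpose (diagonal_matrix d) = diagonal_matrix d"
  by (auto simp: diagonal_matrix_def transpose_def vec_eq_iff)

lemma det_diagonal_matrix: "det (diagonal_matrix d) = (\<Prod>i\<in>UNIV. d i)"
  by (subst det_diagonal) (auto simp: diagonal_matrix_def)

lemma diagonal_matrix_vector_nth: "(diagonal_matrix d *v x) $ i = d i * x $ i"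
  by (simp add: diagonal_matrix_def matrix_vector_mult_def if_distrib[of "\<lambda>x. x * _"] cong: if_cong)

lemma pos_def_diagonal_matrix:
  assumes "\<And>i. 0 < d i"
  shows "pos_def (diagonal_matrix d)"
  unfolding pos_def_def
proof (intro conjI allI impI)
  fix x :: "real^'a" assume "x \<noteq> 0"
  then obtain i where i: "x $ i \<noteq> 0" by (auto simp: vec_eq_iff)
  have "0 < (\<Sum>j\<in>UNIV. d j * (x $ j)\<^sup>2)"
    using assms i by (intro sum_pos2[of _ i]) (auto simp: less_imp_le)
  then show "0 < x \<bullet> (diagonal_matrix d *v x)"
    by (simp add: inner_vec_def diagonal_matrix_vector_nth power2_eq_square mult_ac)
qed simp

lemma orthogonal_diagonalization:
  fixes A :: "real^'n^'n"
  assumes sym: "transpose A = A"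
  obtains P :: "real^'n^'n" and d :: "'n \<Rightarrow> real" where "transpose P ** P = mat 1" "P ** transpose P = mat 1"
    "A = P ** diagonal_matrix d ** transpose P"
    "\<And>i. column i P \<noteq> 0" "\<And>i. A *v column i P = d i *\<^sub>R column i P"
proof -
  obtain v :: "'n \<Rightarrow> real^'n" and d where v: "\<And>i j. v i \<bullet> v j = (if i = j then 1 else 0)" "\<And>i. A *v v i = d i *\<^sub>R v i"
    using symmetric_eigenbasis[OF sym] by metis
  define P where "P = (\<chi> i j. v j $ i)"
  have col: "column i P = v i" for i by (simp add: column_def P_def vec_eq_iff)
  have PP: "transpose P ** P = mat 1"
    by (simp add: matrix_mult_transpose_dot_column col v mat_def)
  then have PP': "P ** transpose P = mat 1" by (rule matrix_left_right_inverse1)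
  have "(A ** P) $ i $ j = (P ** diagonal_matrix d) $ i $ j" for i j
  proof -
    have "(A ** P) $ i $ j = (A *v v j) $ i"
      by (simp add: matrix_matrix_mult_def matrix_vector_mult_def P_def)
    then show ?thesis
      by (simp add: v matrix_matrix_mult_def diagonal_matrix_def P_def if_distrib[of "\<lambda>x. _ * x"] cong: if_cong)
  qed
  then have "A ** P = P ** diagonal_matrix d" by (simp add: vec_eq_iff)
  then have A: "A = P ** diagonal_matrix d ** transpose P"
    by (metis PP' matrix_mul_assoc matrix_mul_rid)
  have "v i \<noteq> 0" for i using v(1)[of i i] by auto
  then show ?thesis using that[OF PP PP' A] by (simp add: col v)
qed

section \<open>Square roots and determinants of positive definite matrices\<close>

lemma pos_def_congruence:
  fixes P :: "real^'n^'n"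
  assumes "pos_def A" "invertible P"
  shows "pos_def (P ** A ** transpose P)"
  unfolding pos_def_def
proof (intro conjI allI impI)
  show "transpose (P ** A ** transpose P) = P ** A ** transpose P"
    by (simp add: matrix_transpose_mul pos_defD(1)[OF assms(1)] matrix_mul_assoc)
  fix x :: "real^'n" assume x: "x \<noteq> 0"
  have "transpose P *v x \<noteq> 0"
    using transpose_invertible[OF assms(2)] x
    unfolding invertible_left_inverse matrix_left_invertible_ker by blast
  from pos_defD(2)[OF assms(1) this] show "0 < x \<bullet> (P ** A ** transpose P *v x)"
    by (simp only: matrix_vector_mul_assoc[symmetric] inner_matrix_vector_transpose[of x P])
qed

text \<open>
  Existence is read off from the diagonalization. For uniqueness, a positive definite root \<open>U\<close> of
  \<open>V\<close> must act on each eigenvector of \<open>V\<close> as multiplication by the root of the eigenvalue, so it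
  agrees with the constructed root on a basis.
\<close>

lemma pos_def_sqrt_ex1:
  fixes V :: "real^'n^'n"
  assumes V: "pos_def V"
  shows "\<exists>!W. pos_def W \<and> W ** W = V"
proof -
  obtain P :: "real^'n^'n" and d where P: "transpose P ** P = mat 1" "P ** transpose P = mat 1"
    "V = P ** diagonal_matrix d ** transpose P"
    "\<And>i. column i P \<noteq> 0" "\<And>i. V *v column i P = d i *\<^sub>R column i P"
    using orthogonal_diagonalization[OF pos_defD(1)[OF V]] by metis
  have d: "0 < d i" for i
    using pos_defD(2)[OF V P(4)[of i]] P(4)[of i] by (simp add: P(5) zero_less_mult_iff)
      (metis inner_ge_zero not_le)
  define D where "D = diagonal_matrix (\<lambda>i. sqrt (d i))"
  have DD: "D ** D = diagonal_matrix d"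
    using d by (simp add: D_def diagonal_matrix_mult less_imp_le)
  have inv: "invertible P" using P(1) invertible_left_inverse by blast
  show ?thesis
  proof (intro ex1I conjI; (elim conjE)?)
    show "pos_def (P ** D ** transpose P)"
      unfolding D_def using d inv by (intro pos_def_congruence pos_def_diagonal_matrix) auto
    have "P ** D ** transpose P ** (P ** D ** transpose P) = P ** D ** (transpose P ** P) ** D ** transpose P"
      by (simp only: matrix_mul_assoc)
    also have "\<dots> = P ** (D ** D) ** transpose P" by (simp add: P(1) matrix_mul_assoc)
    finally show "P ** D ** transpose P ** (P ** D ** transpose P) = V" by (simp add: DD P(3)[symmetric])
  next
    fix U assume U: "pos_def U" "U ** U = V"
    have ev: "U *v column i P = sqrt (d i) *\<^sub>R column i P" for i
    proof -
      define w where "w = U *v column i P - sqrt (d i) *\<^sub>R column i P"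
      \<comment> \<open>\<open>w\<close> would be an eigenvector of \<open>U\<close> for a negative eigenvalue\<close>
      have "U *v w = - sqrt (d i) *\<^sub>R w"
        using d[of i] by (simp add: w_def matrix_vector_mult_diff_distrib matrix_vector_mult_scaleR
            matrix_vector_mul_assoc U P(5) scaleR_diff_right less_imp_le)
      then have "w \<bullet> (U *v w) \<le> 0" using d[of i] by (simp add: less_imp_le)
      then have "w = 0" using pos_defD(2)[OF U(1), of w] by linarith
      then show ?thesis by (simp add: w_def)
    qed
    have "(U ** P) $ i $ j = (P ** D) $ i $ j" for i j
    proof -
      have "(U ** P) $ i $ j = (U *v column j P) $ i"
        by (simp add: matrix_matrix_mult_def matrix_vector_mult_def column_def)
      then show ?thesis
        by (simp only: ev) (simp add: matrix_matrix_mult_def D_def diagonal_matrix_def column_def if_distrib[of "\<lambda>x. _ * x"] cong: if_cong)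
    qed
    then have "U ** P = P ** D" by (simp add: vec_eq_iff)
    then show "U = P ** D ** transpose P"
      by (metis P(2) matrix_mul_assoc matrix_mul_rid)
  qed
qed

lemma pos_def_matrix_sqrt:
  assumes "pos_def V"
  shows "pos_def (matrix_sqrt V)" "matrix_sqrt V ** matrix_sqrt V = V"
  using theI'[OF pos_def_sqrt_ex1[OF assms]] by (auto simp: matrix_sqrt_def)

lemma det_pos_def_pos:
  assumes "pos_def V"
  shows "0 < det V"
proof -
  have "det (matrix_sqrt V) \<noteq> 0"
    using pos_def_invertible[OF pos_def_matrix_sqrt(1)[OF assms]] by (simp add: invertible_det_nz)
  moreover have "det V = det (matrix_sqrt V) * det (matrix_sqrt V)"
    by (metis assms det_mul pos_def_matrix_sqrt(2))
  ultimately show ?thesis by (metis not_real_square_gt_zero)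
qed

lemma det_ge_1:
  fixes A :: "real^'n^'n"
  assumes sym: "transpose A = A" and ge: "\<And>x. x \<bullet> x \<le> x \<bullet> (A *v x)"
  shows "1 \<le> det A"
proof -
  obtain P :: "real^'n^'n" and d where P: "transpose P ** P = mat 1" "P ** transpose P = mat 1"
    "A = P ** diagonal_matrix d ** transpose P"
    "\<And>i. column i P \<noteq> 0" "\<And>i. A *v column i P = d i *\<^sub>R column i P"
    using orthogonal_diagonalization[OF sym] by metis
  have d: "1 \<le> d i" for i
  proof -
    have "0 < column i P \<bullet> column i P" using P(4)[of i] by simp
    with ge[of "column i P"] show ?thesis by (simp add: P(5))
  qed
  have "det P * det P = 1" by (metis P(1) det_I det_mul det_transpose)
  then have "det A = (\<Prod>i\<in>UNIV. d i)"
    by (subst P(3)) (simp add: det_mul det_transpose det_diagonal_matrix)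
  then show ?thesis using d by (simp add: prod_ge_1)
qed

text \<open>
  Congruence with \<open>A\<^sup>-\<^sup>1\<^sup>/\<^sup>2\<close> reduces the claim to \<open>A = I\<close>, where every eigenvalue of \<open>B\<close> is at
  least 1.
\<close>

lemma det_mono:
  fixes A B :: "real^'n^'n"
  assumes A: "pos_def A" and B: "transpose B = B" and le: "\<And>x. x \<bullet> (A *v x) \<le> x \<bullet> (B *v x)"
  shows "det A \<le> det B"
proof -
  define W where "W = matrix_sqrt A"
  define N where "N = matrix_inv W"
  have W: "pos_def W" "W ** W = A" using pos_def_matrix_sqrt[OF A] by (auto simp: W_def)
  have N: "pos_def N" using pos_def_matrix_inv[OF W(1)] by (simp add: N_def)
  have WN: "W ** N = mat 1" "N ** W = mat 1" using pos_def_inv_cancel[OF W(1)] by (auto simp: N_def)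
  have NAN: "N ** A ** N = mat 1"
    unfolding W(2)[symmetric] using WN by (simp add: matrix_mul_assoc)
  have "1 \<le> det (N ** B ** N)"
  proof (rule det_ge_1)
    show "transpose (N ** B ** N) = N ** B ** N"
      by (simp add: matrix_transpose_mul B pos_defD(1)[OF N] matrix_mul_assoc)
    have c: "x \<bullet> (N ** M ** N *v x) = (N *v x) \<bullet> (M *v (N *v x))" for M x
      by (metis inner_matrix_vector_transpose matrix_vector_mul_assoc N pos_defD(1))
    show "x \<bullet> x \<le> x \<bullet> (N ** B ** N *v x)" for x
      using le[of "N *v x"] c[of x A] c[of x B] by (simp add: NAN)
  qed
  also have "det (N ** B ** N) = det B / det A"
  proof -
    have "det N * det A * det N = 1" by (metis NAN det_I det_mul)
    then have "det A * (det N * det N) = 1" by (simp add: mult_ac)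
    with det_pos_def_pos[OF A] show ?thesis
      by (simp add: det_mul field_simps)
  qed
  finally show ?thesis using det_pos_def_pos[OF A] by simp
qed

section \<open>The discrete Lyapunov equation\<close>

lemma transpose_add: "transpose (A + B) = transpose A + transpose (B :: real^'n^'m)"
  by (simp add: transpose_def vec_eq_iff)

lemma matrix_add_rdistrib: "(A + B) ** C = A ** C + B ** (C :: real^'k^'n)"
  by (simp add: matrix_matrix_mult_def vec_eq_iff sum.distrib distrib_right)

lemma matrix_vector_mult_uminus: "(- A) *v x = - (A *v (x :: real^'n))"
  by (simp add: matrix_vector_mult_def vec_eq_iff sum_negf)

lemma inner_congruence:
  fixes A X :: "real^'n^'n"
  shows "x \<bullet> (A ** X ** transpose A *v y) = (transpose A *v x) \<bullet> (X *v (transpose A *v y))"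
  by (simp only: matrix_vector_mul_assoc[symmetric] inner_matrix_vector_transpose[of x A])

lemma symmetric_eq_zeroI:
  fixes X :: "real^'n^'n"
  assumes sym: "transpose X = X" and zero: "\<And>x. x \<bullet> (X *v x) = 0"
  shows "X = 0"
proof -
  have "x \<bullet> (X *v y) = 0" for x y
    using zero[of "x + y"] zero[of x] zero[of y] inner_matrix_vector_sym[OF sym, of x y]
    by (simp add: matrix_vector_right_distrib inner_add_left inner_add_right)
  then have "X *v y = 0" for y using inner_eq_zero_iff by blast
  then show ?thesis by (simp add: matrix_eq)
qed

text \<open>
  The contraction hypothesis says that \<open>A V A' < V\<close>. It replaces a bound on the spectral radius
  of \<open>A\<close>: the norm in which \<open>A'\<close> contracts is the one given by \<open>V\<close> itself.
\<close>

context
  fixes A V :: "real^'n^'n"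
  assumes V: "pos_def V"
    and contraction: "\<And>x. x \<noteq> 0 \<Longrightarrow> (transpose A *v x) \<bullet> (V *v (transpose A *v x)) < x \<bullet> (V *v x)"
begin

text \<open>
  A discrete maximum principle: at a minimizer \<open>z\<close> of the ratio \<open>x \<bullet> X x / x \<bullet> V x\<close>, a negative
  value would satisfy \<open>z \<bullet> X z < w \<bullet> X w\<close> for \<open>w = A' z\<close>, since the form of \<open>V\<close> is strictly smaller
  at \<open>w\<close>; this contradicts the hypothesis at \<open>z\<close>.
\<close>

lemma Lyapunov_nonneg:
  fixes X :: "real^'n^'n"
  assumes X: "\<And>x. (transpose A *v x) \<bullet> (X *v (transpose A *v x)) \<le> x \<bullet> (X *v x)"
  shows "0 \<le> x \<bullet> (X *v x)"
proof -
  define r where "r x = (x \<bullet> (X *v x)) / (x \<bullet> (V *v x))" for x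
  have "x \<bullet> (V *v x) \<noteq> 0" if "x \<in> sphere 0 1" for x
  proof -
    have "x \<noteq> 0" using that by auto
    from pos_defD(2)[OF V this] show ?thesis by simp
  qed
  then have "continuous_on (sphere 0 1) r"
    unfolding r_def
    by (intro continuous_intros linear_continuous_on matrix_vector_mul_bounded_linear) blast
  moreover have "sphere (0 :: real^'n) 1 \<noteq> {}" by simp
  ultimately obtain z where z: "norm z = 1" and min: "\<And>y. norm y = 1 \<Longrightarrow> r z \<le> r y"
    using continuous_attains_inf[of "sphere 0 1" r] by auto
  have z0: "z \<noteq> 0" using z by auto
  have low: "r z * (y \<bullet> (V *v y)) \<le> y \<bullet> (X *v y)" for y
  proof (cases "y = 0")
    case False
    have "r (y /\<^sub>R norm y) = r y"
      using False by (simp add: r_def matrix_vector_mult_scaleR)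
    then have "r z \<le> r y" using min[of "y /\<^sub>R norm y"] False by simp
    then show ?thesis using pos_defD(2)[OF V False] by (simp add: r_def pos_le_divide_eq)
  qed simp
  have "0 \<le> r z"
  proof (rule ccontr)
    assume neg: "\<not> 0 \<le> r z"
    let ?w = "transpose A *v z"
    have "r z * (z \<bullet> (V *v z)) < r z * (?w \<bullet> (V *v ?w))"
      using contraction[OF z0] neg by simp
    also have "\<dots> \<le> ?w \<bullet> (X *v ?w)" by (rule low)
    also have "\<dots> \<le> z \<bullet> (X *v z)" by (rule X)
    also have "\<dots> = r z * (z \<bullet> (V *v z))" using pos_defD(2)[OF V z0] by (simp add: r_def)
    finally show False by simp
  qed
  with low[of x] pos_defD(3)[OF V, of x] show ?thesis
    by (meson mult_nonneg_nonneg order_trans)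
qed

lemma Lyapunov_zero:
  fixes X :: "real^'n^'n"
  assumes sym: "transpose X = X" and X: "X = A ** X ** transpose A"
  shows "X = 0"
proof (rule symmetric_eq_zeroI[OF sym])
  fix x :: "real^'n"
  have eq: "(transpose A *v y) \<bullet> (X *v (transpose A *v y)) = y \<bullet> (X *v y)" for y
    using inner_congruence[of y A X y] by (simp only: X[symmetric])
  have "0 \<le> x \<bullet> (X *v x)"
    by (rule Lyapunov_nonneg) (simp only: eq order_refl)
  moreover have "0 \<le> x \<bullet> (- X *v x)"
    by (rule Lyapunov_nonneg) (simp only: eq matrix_vector_mult_uminus inner_minus_right order_refl)
  ultimately show "x \<bullet> (X *v x) = 0" by (simp add: matrix_vector_mult_uminus)
qed

text \<open>
  In finite dimension, uniqueness for the homogeneous linear equation implies existence. The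
  maximum principle gives uniqueness among symmetric matrices only; the map \<open>L\<close> therefore
  symmetrizes \<open>X\<close> inside the congruence. It agrees with \<open>X - A X A'\<close> on symmetric matrices, and
  \<open>L X\<close> is symmetric only if \<open>X\<close> is, so \<open>L\<close> is injective on all matrices.
\<close>

lemma Lyapunov_ex1:
  fixes Q :: "real^'n^'n"
  assumes Q: "transpose Q = Q"
  shows "\<exists>!X. transpose X = X \<and> X = Q + A ** X ** transpose A"
proof -
  define L where "L X = X - A ** ((1/2) *\<^sub>R (X + transpose X)) ** transpose A" for X :: "real^'n^'n"
  have lin: "linear L"
  proof (rule linearI)
    have F_add: "A ** (Y + Z) ** transpose A = A ** Y ** transpose A + A ** Z ** transpose A" for Y Z
      by (simp only: matrix_add_ldistrib matrix_add_rdistrib)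
    have F_scaleR: "A ** (k *\<^sub>R Y) ** transpose A = k *\<^sub>R (A ** Y ** transpose A)" for k Y
      by (metis matrix_scalar_ac scalar_matrix_assoc)
    show "L (X + Y) = L X + L Y" for X Y
      by (simp only: L_def transpose_add F_add F_scaleR scaleR_add_right) simp
    show "L (k *\<^sub>R X) = k *\<^sub>R L X" for k X
      by (simp only: L_def transpose_scalar F_add F_scaleR scaleR_add_right scaleR_diff_right)
         (simp add: mult.commute)
  qed
  have symA: "transpose (A ** ((1/2) *\<^sub>R (X + transpose X)) ** transpose A)
      = A ** ((1/2) *\<^sub>R (X + transpose X)) ** transpose A" for X :: "real^'n^'n"
    by (simp add: matrix_transpose_mul transpose_scalar transpose_add matrix_mul_assoc add.commute)
  have L_sym: "L X = X - A ** X ** transpose A" if "transpose X = X" for X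
    by (simp add: L_def that scaleR_2[symmetric])
  have sym_L: "transpose X = X" if "transpose (L X) = L X" for X
  proof -
    have X: "X = L X + A ** ((1/2) *\<^sub>R (X + transpose X)) ** transpose A" by (simp add: L_def)
    have "transpose X = transpose (L X) + transpose (A ** ((1/2) *\<^sub>R (X + transpose X)) ** transpose A)"
      by (subst X) (rule transpose_add)
    then show ?thesis unfolding that symA X[symmetric] .
  qed
  have ker: "X = 0" if "L X = 0" for X
  proof -
    have Xs: "transpose X = X" by (rule sym_L) (simp add: that transpose_def vec_eq_iff)
    have "X - A ** X ** transpose A = 0" using that by (simp only: L_sym[OF Xs])
    then show ?thesis by (intro Lyapunov_zero Xs) (rule iffD1[OF right_minus_eq])
  qed
  have "inj L" using ker lin by (simp add: linear_injective_0)
  then have "surj L" using linear_injective_imp_surjective[OF lin] by blast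
  then obtain X where X: "L X = Q" by (metis surjD)
  then have Xs: "transpose X = X" using Q sym_L by simp
  show ?thesis
  proof (rule ex1I[of _ X])
    show "transpose X = X \<and> X = Q + A ** X ** transpose A"
      using X Xs L_sym[OF Xs] by (simp add: algebra_simps)
  next
    fix Y assume Y: "transpose Y = Y \<and> Y = Q + A ** Y ** transpose A"
    then have Ys: "transpose Y = Y" and YQ: "Y = Q + A ** Y ** transpose A" by blast+
    from YQ have "Y - A ** Y ** transpose A = Q" by (rule iffD2[OF diff_eq_eq])
    then have "L Y = Q" by (simp only: L_sym[OF Ys])
    then show "Y = X" using X \<open>inj L\<close> by (simp add: inj_def)
  qed
qed

end

section \<open>Operator norm and quadratic forms\<close>

lemma norm_le_matrix_norm: "norm (A *v x) \<le> matrix_norm A * norm (x :: real^'n)"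
  unfolding matrix_norm_def by (rule onorm) simp

lemma matrix_norm_nonneg: "0 \<le> matrix_norm (A :: real^'n^'n)"
  unfolding matrix_norm_def by (rule onorm_pos_le) simp

lemma matrix_norm_mult_le: "matrix_norm (A ** B) \<le> matrix_norm A * matrix_norm (B :: real^'n^'n)"
  using onorm_compose[of "(*v) A" "(*v) B"]
  by (simp add: matrix_norm_def o_def matrix_vector_mul_assoc)

lemma matrix_norm_transpose_le: "matrix_norm (transpose A) \<le> matrix_norm (A :: real^'n^'n)"
  unfolding matrix_norm_def[of "transpose A"]
proof (rule onorm_le)
  fix x :: "real^'n"
  let ?y = "transpose A *v x"
  have "norm ?y * norm ?y = x \<bullet> (A *v ?y)"
    by (simp only: inner_matrix_vector_transpose[of x A] power2_norm_eq_inner[symmetric] power2_eq_square)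
  also have "\<dots> \<le> norm x * norm (A *v ?y)" by (rule norm_cauchy_schwarz)
  also have "\<dots> \<le> norm x * (matrix_norm A * norm ?y)"
    by (intro mult_left_mono norm_le_matrix_norm) auto
  finally have "norm ?y * norm ?y \<le> (matrix_norm A * norm x) * norm ?y" by (simp add: mult_ac)
  moreover have "0 \<le> matrix_norm A * norm x"
    by (intro mult_nonneg_nonneg matrix_norm_nonneg norm_ge_zero)
  moreover have "0 \<le> norm ?y" by (rule norm_ge_zero)
  ultimately show "norm ?y \<le> matrix_norm A * norm x"
    by (metis mult_right_le_imp_le order_le_less)
qed

lemma inner_le_matrix_norm:
  fixes A :: "real^'n^'n"
  shows "x \<bullet> (A *v x) \<le> matrix_norm A * (x \<bullet> x)"
proof -
  have "x \<bullet> (A *v x) \<le> norm x * norm (A *v x)" by (rule norm_cauchy_schwarz)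
  also have "\<dots> \<le> norm x * (matrix_norm A * norm x)"
    by (intro mult_left_mono norm_le_matrix_norm) auto
  also have "\<dots> = matrix_norm A * (x \<bullet> x)"
    by (simp add: power2_norm_eq_inner[symmetric] power2_eq_square)
  finally show ?thesis .
qed

text \<open>
  The largest eigenvalue of a symmetric matrix bounds its quadratic form, and it is also an
  eigenvalue of the similar matrix, hence at most the norm of that matrix.
\<close>

lemma symmetric_le_norm_of_similar:
  fixes T W :: "real^'n^'n"
  assumes sym: "transpose T = T" and W: "invertible W"
  shows "x \<bullet> (T *v x) \<le> matrix_norm (matrix_inv W ** T ** W) * (x \<bullet> x)"
proof -
  obtain e :: "real^'n" where "norm e = 1" using vector_choose_size[of 1] by auto
  then have "e \<noteq> 0" by auto
  then have ne: "(UNIV :: (real^'n) set) \<noteq> {0}" by blast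
  obtain l v where v: "norm v = 1" "T *v v = l *\<^sub>R v"
    and max: "\<And>y. y \<in> UNIV \<Longrightarrow> y \<bullet> (T *v y) \<le> l * (y \<bullet> y)"
    by (rule Rayleigh_maximizer[OF sym subspace_UNIV ne]) (rule UNIV_I, blast)
  define u where "u = matrix_inv W *v v"
  have Wu: "W *v u = v" by (simp add: u_def matrix_vector_mul_assoc matrix_inv_cancel[OF W])
  then have u0: "norm u > 0" using v by auto
  have "(matrix_inv W ** T ** W) *v u = l *\<^sub>R u"
    by (simp add: matrix_vector_mul_assoc[symmetric] Wu v matrix_vector_mult_scaleR) (simp add: u_def)
  then have "\<bar>l\<bar> * norm u \<le> matrix_norm (matrix_inv W ** T ** W) * norm u"
    by (metis norm_le_matrix_norm norm_scaleR)
  then have "l \<le> matrix_norm (matrix_inv W ** T ** W)" using u0 by simp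
  then show ?thesis using max[of x, OF UNIV_I] by (meson inner_ge_zero mult_right_mono order_trans)
qed

section \<open>One Euler step of the Langevin diffusion\<close>

text \<open>
  For the drift matrix \<open>B = - (I + S) V\<^sup>-\<^sup>1\<close> this is \<open>B V B'\<close>, the covariance of \<open>B x\<close> when \<open>x\<close> has
  covariance \<open>V\<close>. It is the second order term of one Euler step.
\<close>

definition drift_covariance :: "real^'n^'n \<Rightarrow> real^'n^'n \<Rightarrow> real^'n^'n" where
  "drift_covariance V S = (mat 1 + S) ** matrix_inv V ** (mat 1 - S)"

definition drift_similar_norm :: "real^'n^'n \<Rightarrow> real^'n^'n \<Rightarrow> real" where
  "drift_similar_norm V S = matrix_norm (matrix_inv (matrix_sqrt V) ** (mat 1 + S) ** matrix_inv V
                     ** (mat 1 - S) ** matrix_sqrt V)"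

definition drift_norm_bound :: "real^'n^'n \<Rightarrow> real^'n^'n \<Rightarrow> real" where
  "drift_norm_bound V S = (matrix_norm (matrix_inv (matrix_sqrt V) ** (mat 1 + S)
                     ** matrix_inv (matrix_sqrt V)))\<^sup>2 * matrix_norm V"

context
  fixes V S :: "real^'n^'n"
  assumes V: "pos_def V" and S: "transpose S = - S"
begin

lemma transpose_I_plus_S: "transpose (mat 1 + S) = mat 1 - S" "transpose (mat 1 - S) = mat 1 + S"
  using S transpose_add[of "mat 1" S] transpose_add[of "mat 1" "- S"]
   transpose_transpose[of S] by simp_all

lemma I_minus_S_inner: "x \<bullet> ((mat 1 - S) *v x) = x \<bullet> x"
proof -
  have "x \<bullet> (S *v x) = - (x \<bullet> (S *v x))"
    by (subst inner_matrix_vector_transpose) (simp only: S matrix_vector_mult_uminus inner_minus_left inner_commute[of x])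
  then show ?thesis by (simp add: matrix_vector_mult_diff_rdistrib inner_diff_right)
qed

lemma inner_drift_covariance:
  "x \<bullet> (drift_covariance V S *v x) = ((mat 1 - S) *v x) \<bullet> (matrix_inv V *v ((mat 1 - S) *v x))"
  using inner_congruence[of x "mat 1 + S" "matrix_inv V" x]
  by (simp only: drift_covariance_def transpose_I_plus_S)

lemma pos_def_drift_covariance: "pos_def (drift_covariance V S)"
proof -
  have "invertible (mat 1 + S)"
  proof -
    have "invertible (mat 1 - S)"
      unfolding invertible_left_inverse matrix_left_invertible_ker
    proof (intro allI impI)
      fix x :: "real^'n" assume "(mat 1 - S) *v x = 0"
      then show "x = 0" using I_minus_S_inner[of x] by simp
    qed
    from transpose_invertible[OF this] show ?thesis by (simp add: transpose_I_plus_S)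
  qed
  from pos_def_congruence[OF pos_def_matrix_inv[OF V] this]
  show ?thesis by (simp add: drift_covariance_def transpose_I_plus_S)
qed

lemma drift_covariance_le: "x \<bullet> (drift_covariance V S *v x) \<le> drift_similar_norm V S * (x \<bullet> x)"
  using symmetric_le_norm_of_similar[OF pos_defD(1)[OF pos_def_drift_covariance]
      pos_def_invertible[OF pos_def_matrix_sqrt(1)[OF V]], of x]
  by (simp add: drift_similar_norm_def drift_covariance_def matrix_mul_assoc)

lemma drift_similar_norm_pos: "0 < drift_similar_norm V S"
proof -
  obtain x :: "real^'n" where x: "norm x = 1" using vector_choose_size[of 1] by auto
  then have "0 < x \<bullet> (drift_covariance V S *v x)" by (intro pos_defD(2)[OF pos_def_drift_covariance]) auto
  also have "\<dots> \<le> drift_similar_norm V S * 1" using drift_covariance_le[of x] x by (simp add: dot_square_norm)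
  finally show ?thesis by simp
qed

text \<open>
  With \<open>W = V\<^sup>1\<^sup>/\<^sup>2\<close> and \<open>M = W\<^sup>-\<^sup>1 (I + S) W\<^sup>-\<^sup>1\<close>, the matrix on the left is \<open>M M' V\<close>, and the right hand
  side is \<open>\<parallel>M\<parallel>\<^sup>2 \<parallel>V\<parallel>\<close>.
\<close>

lemma drift_similar_norm_le_bound: "drift_similar_norm V S \<le> drift_norm_bound V S"
proof -
  define W where "W = matrix_sqrt V"
  define N where "N = matrix_inv W"
  define M where "M = N ** (mat 1 + S) ** N"
  have W: "pos_def W" "W ** W = V" using pos_def_matrix_sqrt[OF V] by (auto simp: W_def)
  have WN: "W ** N = mat 1" "N ** W = mat 1" using pos_def_inv_cancel[OF W(1)] by (auto simp: N_def)
  have "V ** (N ** N) = W ** (W ** N) ** N" by (simp only: W(2)[symmetric] matrix_mul_assoc)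
  then have Vinv: "matrix_inv V = N ** N" by (intro matrix_inv_unique) (simp add: WN)
  have N: "transpose N = N" using pos_def_matrix_inv[OF W(1)] by (simp add: N_def pos_defD)
  have Mt: "transpose M = N ** (mat 1 - S) ** N"
    by (simp add: M_def matrix_transpose_mul N transpose_I_plus_S matrix_mul_assoc)
  have "M ** transpose M ** V = N ** (mat 1 + S) ** (N ** N) ** (mat 1 - S) ** (N ** W) ** W"
    unfolding Mt unfolding M_def W(2)[symmetric] by (simp only: matrix_mul_assoc)
  then have "drift_similar_norm V S = matrix_norm (M ** transpose M ** V)"
    by (simp add: drift_similar_norm_def Vinv WN W_def[symmetric] N_def[symmetric])
  also have "\<dots> \<le> matrix_norm M * matrix_norm (transpose M) * matrix_norm V"
    using matrix_norm_mult_le[of "M ** transpose M" V] matrix_norm_mult_le[of M "transpose M"]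
    by (meson matrix_norm_nonneg mult_right_mono order_trans)
  also have "\<dots> \<le> matrix_norm M * matrix_norm M * matrix_norm V"
    by (intro mult_right_mono mult_left_mono matrix_norm_transpose_le matrix_norm_nonneg)
  also have "\<dots> = drift_norm_bound V S" by (simp add: drift_norm_bound_def M_def N_def W_def power2_eq_square)
  finally show ?thesis .
qed

text \<open>
  The identity \<open>A V A' = V - 2 h I + h\<^sup>2 B V B'\<close> for \<open>A = I + h B\<close>: to first order in \<open>h\<close> the skew part
  \<open>S\<close> cancels, since \<open>B V + V B' = - (I + S) - (I - S)\<close>.
\<close>

lemma transition_form:
  fixes h :: real
  defines "A \<equiv> mat 1 + h *\<^sub>R (- ((mat 1 + S) ** matrix_inv V))"
  shows "(transpose A *v x) \<bullet> (V *v (transpose A *v x))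
    = x \<bullet> (V *v x) - 2 * h * (x \<bullet> x) + h\<^sup>2 * (x \<bullet> (drift_covariance V S *v x))"
proof -
  define w where "w = (mat 1 - S) *v x"
  have "A = mat 1 + (- h) *\<^sub>R ((mat 1 + S) ** matrix_inv V)" by (simp add: A_def)
  then have "transpose A = mat 1 + (- h) *\<^sub>R (matrix_inv V ** (mat 1 - S))"
    by (simp only: transpose_add[of "mat 1" "(- h) *\<^sub>R ((mat 1 + S) ** matrix_inv V)"] transpose_scalar matrix_transpose_mul transpose_I_plus_S
      pos_defD(1)[OF pos_def_matrix_inv[OF V]] transpose_mat)
  then have Ax: "transpose A *v x = x - h *\<^sub>R (matrix_inv V *v w)"
    by (simp only: w_def matrix_vector_mult_add_rdistrib scaleR_matrix_vector_assoc[symmetric]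
       matrix_vector_mul_assoc[symmetric] matrix_vector_mul_lid) simp
  have VAx: "V *v (transpose A *v x) = V *v x - h *\<^sub>R w"
    by (simp only: Ax matrix_vector_mult_diff_distrib matrix_vector_mult_scaleR pos_def_inv_cancel_vec[OF V])
  have 1: "(matrix_inv V *v w) \<bullet> (V *v x) = x \<bullet> w"
    using inner_matrix_vector_sym[OF pos_defD(1)[OF V], of "matrix_inv V *v w" x]
    by (simp add: pos_def_inv_cancel_vec[OF V])
  have 2: "x \<bullet> w = x \<bullet> x" by (simp add: w_def I_minus_S_inner)
  have 3: "x \<bullet> (drift_covariance V S *v x) = w \<bullet> (matrix_inv V *v w)" by (simp only: inner_drift_covariance w_def)
  have "(x - h *\<^sub>R (matrix_inv V *v w)) \<bullet> (V *v x - h *\<^sub>R w)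
    = x \<bullet> (V *v x) - 2 * h * (x \<bullet> x) + h\<^sup>2 * (w \<bullet> (matrix_inv V *v w))"
    using 1 2 by (simp add: inner_diff_left inner_diff_right inner_commute[of "matrix_inv V *v w" w]
      power2_eq_square algebra_simps)
  then show ?thesis by (simp only: VAx) (simp only: Ax 3)
qed

end

section \<open>Gaussian densities\<close>

lemma continuous_on_matrix_vector [continuous_intros]:
  "continuous_on s f \<Longrightarrow> continuous_on s (\<lambda>x. A *v (f x :: real^'n))"
  by (rule bounded_linear.continuous_on[OF matrix_vector_mul_bounded_linear])

lemma mv_normal_density_pos:
  assumes "pos_def \<Sigma>"
  shows "0 < mv_normal_density m \<Sigma> x"
  using det_pos_def_pos[OF assms] by (simp add: mv_normal_density_def)

lemma mv_normal_density_measurable [measurable]: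
  "mv_normal_density m \<Sigma> \<in> borel_measurable borel"
  unfolding mv_normal_density_def
  by (intro borel_measurable_divide borel_measurable_exp borel_measurable_const
      borel_measurable_continuous_onI continuous_intros) simp_all

lemma mv_normal_density_kernel_measurable:
  "(\<lambda>(x, y). mv_normal_density (A *v x) \<Sigma> y) \<in> borel_measurable borel"
  unfolding mv_normal_density_def split_beta
  by (intro borel_measurable_divide borel_measurable_exp borel_measurable_const
      borel_measurable_continuous_onI continuous_intros) simp_all

lemma mv_normal_density_isotropic:
  fixes m x :: "real^'n"
  assumes s: "0 < s"
  shows "mv_normal_density m (s *\<^sub>R mat 1) x
    = exp (- ((x - m) \<bullet> (x - m)) / (2 * s)) / sqrt (2 * pi * s) ^ CARD('n)"
proof -
  have "det (s *\<^sub>R mat 1 :: real^'n^'n) = (\<Prod>i\<in>(UNIV::'n set). s)"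
    by (subst det_diagonal) (auto simp: mat_def)
  then have "(2 * pi) ^ CARD('n) * det (s *\<^sub>R mat 1 :: real^'n^'n) = (2 * pi * s) ^ CARD('n)"
    by (simp only: prod_constant power_mult_distrib)
  then have "sqrt ((2 * pi) ^ CARD('n) * det (s *\<^sub>R mat 1 :: real^'n^'n)) = sqrt (2 * pi * s) ^ CARD('n)"
    by (simp only: real_sqrt_power)
  then show ?thesis using s
    by (simp add: mv_normal_density_def matrix_inv_scaled_identity scaleR_matrix_vector_assoc[symmetric])
qed

lemma nn_integral_isotropic_normal:
  fixes m :: "real^'n"
  assumes s: "0 < s"
  shows "(\<integral>\<^sup>+x. ennreal (mv_normal_density m (s *\<^sub>R mat 1) x) \<partial>lborel) = 1"
proof -
  have prod: "mv_normal_density m (s *\<^sub>R mat 1) x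
      = (\<Prod>b\<in>Basis. normal_density (m \<bullet> b) (sqrt s) (x \<bullet> b))" for x
  proof -
    have "(\<Prod>b\<in>Basis. normal_density (m \<bullet> b) (sqrt s) (x \<bullet> b))
      = (\<Prod>b\<in>Basis. exp (- ((x - m) \<bullet> b)\<^sup>2 / (2 * s)) / sqrt (2 * pi * s))"
      using s by (simp add: normal_density_def inner_diff_left)
    also have "\<dots> = exp (\<Sum>b\<in>Basis. - ((x - m) \<bullet> b)\<^sup>2 / (2 * s)) / sqrt (2 * pi * s) ^ CARD('n)"
      by (simp add: prod_dividef exp_sum)
    also have "(\<Sum>b\<in>Basis. - ((x - m) \<bullet> b)\<^sup>2 / (2 * s)) = - ((x - m) \<bullet> (x - m)) / (2 * s)"
      by (subst (2) euclidean_inner) (simp add: sum_negf sum_divide_distrib power2_eq_square)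
    finally show ?thesis using s by (simp add: mv_normal_density_isotropic)
  qed
  have one: "(\<integral>\<^sup>+x. ennreal (normal_density \<mu> (sqrt s) x) \<partial>lborel) = 1" for \<mu>
    using s by (subst nn_integral_eq_integral) auto
  have "(\<integral>\<^sup>+x. ennreal (mv_normal_density m (s *\<^sub>R mat 1) x) \<partial>lborel)
    = (\<integral>\<^sup>+x. (\<Prod>b\<in>Basis. ennreal (normal_density (m \<bullet> b) (sqrt s) (x \<bullet> b))) \<partial>lborel)"
    by (simp add: prod prod_ennreal)
  also have "\<dots> = 1" by (subst nn_integral_lborel_prod) (auto simp: one)
  finally show ?thesis .
qed

text \<open>
  Since \<open>\<Sigma> \<le> t I\<close> for \<open>t\<close> above the norm of \<open>\<Sigma>\<close>, the density is bounded by a multiple of an isotropic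
  one.
\<close>

lemma nn_integral_mv_normal_finite:
  fixes \<Sigma> :: "real^'n^'n"
  assumes \<Sigma>: "pos_def \<Sigma>"
  shows "(\<integral>\<^sup>+x. ennreal (mv_normal_density 0 \<Sigma> x) \<partial>lborel) < \<infinity>"
proof -
  define t where "t = matrix_norm \<Sigma> + 1"
  have t: "0 < t" using matrix_norm_nonneg[of \<Sigma>] by (simp add: t_def)
  have le: "x \<bullet> (\<Sigma> *v x) \<le> x \<bullet> ((t *\<^sub>R mat 1) *v x)" for x
    using inner_le_matrix_norm[of x \<Sigma>]
    by (simp add: t_def scaleR_matrix_vector_assoc[symmetric] distrib_right add_increasing2)
  have inv: "(x \<bullet> x) / t \<le> x \<bullet> (matrix_inv \<Sigma> *v x)" for x
    using matrix_inv_antimono[OF \<Sigma> pos_def_scaled_identity[OF t] le, of x] t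
    by (simp add: matrix_inv_scaled_identity scaleR_matrix_vector_assoc[symmetric])
  define Z where "Z = sqrt ((2 * pi) ^ CARD('n) * det \<Sigma>)"
  define Y where "Y = sqrt (2 * pi * t) ^ CARD('n)"
  have Z: "0 < Z" using det_pos_def_pos[OF \<Sigma>] by (simp add: Z_def)
  have Y: "0 < Y" using t by (simp add: Y_def)
  have bound: "mv_normal_density 0 \<Sigma> x \<le> Y / Z * mv_normal_density 0 (t *\<^sub>R mat 1) x" for x
  proof -
    have "mv_normal_density 0 \<Sigma> x = exp (- (x \<bullet> (matrix_inv \<Sigma> *v x)) / 2) / Z"
      by (simp add: mv_normal_density_def Z_def)
    also have "\<dots> \<le> exp (- ((x \<bullet> x) / t) / 2) / Z"
      using inv[of x] Z by (simp add: divide_right_mono)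
    also have "\<dots> = Y / Z * mv_normal_density 0 (t *\<^sub>R mat 1) x"
    proof -
      have "mv_normal_density 0 (t *\<^sub>R mat 1) x = exp (- ((x \<bullet> x) / t) / 2) / Y"
        by (simp add: mv_normal_density_isotropic[OF t] Y_def)
      then show ?thesis using Y by simp
    qed
    finally show ?thesis .
  qed
  have "(\<integral>\<^sup>+x. ennreal (mv_normal_density 0 \<Sigma> x) \<partial>lborel)
    \<le> (\<integral>\<^sup>+x. ennreal (Y / Z) * ennreal (mv_normal_density 0 (t *\<^sub>R mat 1) (x :: real^'n)) \<partial>lborel)"
  proof (rule nn_integral_mono)
    fix x :: "real^'n"
    show "ennreal (mv_normal_density 0 \<Sigma> x) \<le> ennreal (Y / Z) * ennreal (mv_normal_density 0 (t *\<^sub>R mat 1) x)"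
      using ennreal_leI[OF bound[of x]] Y Z by (simp only: ennreal_mult'[symmetric] divide_nonneg_nonneg less_imp_le)
  qed
  also have "\<dots> = ennreal (Y / Z)"
    by (subst nn_integral_cmult) (auto simp: nn_integral_isotropic_normal[OF t])
  finally show ?thesis by (simp add: order_le_less_trans)
qed

section \<open>The invariant density\<close>

text \<open>
  If \<open>y\<close> has law \<open>N(0, R)\<close> and \<open>x = A y + \<xi>\<close> with independent noise \<open>\<xi>\<close> of covariance \<open>s I\<close>, then \<open>G x\<close> is the
  conditional mean of \<open>y\<close> given \<open>x\<close>. The Lyapunov equation says that \<open>x\<close> has covariance \<open>R\<close> again,
  which is why \<open>R\<^sup>-\<^sup>1\<close> appears as the marginal form in \<open>x\<close>.
\<close>

lemma complete_square_invariant: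
  fixes A R :: "real^'n^'n"
  assumes R: "pos_def R" and s: "0 < s"
    and eq: "R = s *\<^sub>R mat 1 + A ** R ** transpose A"
  defines "G \<equiv> R ** transpose A ** matrix_inv R"
    and "Q \<equiv> \<lambda>y. y \<bullet> (matrix_inv R *v y) + ((A *v y) \<bullet> (A *v y)) / s"
  shows "y \<bullet> (matrix_inv R *v y) + ((x - A *v y) \<bullet> (x - A *v y)) / s
    = x \<bullet> (matrix_inv R *v x) + Q (y - G *v x)"
proof -
  define u where "u = matrix_inv R *v x"
  define w where "w = transpose A *v u"
  have Gx: "G *v x = R *v w"
    by (simp only: G_def u_def w_def matrix_vector_mul_assoc matrix_mul_assoc)
  have Rz: "R *v z = s *\<^sub>R z + A *v (R *v (transpose A *v z))" for z
    by (subst eq) (simp only: matrix_vector_mult_add_rdistrib scaleR_matrix_vector_assoc[symmetric]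
      matrix_vector_mul_assoc matrix_mul_assoc matrix_vector_mul_lid)
  have AG: "A *v (G *v x) = x - s *\<^sub>R u"
    using Rz[of u] by (simp add: Gx w_def u_def pos_def_inv_cancel_vec[OF R] algebra_simps del: transpose_matrix_vector)
  have y_u: "y \<bullet> (matrix_inv R *v (G *v x)) = (A *v y) \<bullet> u" for y
    by (simp only: Gx pos_def_inv_cancel_vec[OF R] w_def inner_matrix_vector_transpose transpose_transpose)
  have sym: "(G *v x) \<bullet> (matrix_inv R *v y) = y \<bullet> (matrix_inv R *v (G *v x))" for y
    by (rule inner_matrix_vector_sym[OF pos_defD(1)[OF pos_def_matrix_inv[OF R]]])
  have "Q (y - G *v x) = y \<bullet> (matrix_inv R *v y) - 2 * ((A *v y) \<bullet> u) + (x - s *\<^sub>R u) \<bullet> u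
      + ((A *v y - (x - s *\<^sub>R u)) \<bullet> (A *v y - (x - s *\<^sub>R u))) / s"
    using sym[of y] y_u[of y] y_u[of "G *v x"]
    by (simp add: Q_def matrix_vector_mult_diff_distrib inner_diff_left inner_diff_right AG)
  also have "\<dots> = y \<bullet> (matrix_inv R *v y) + ((x - A *v y) \<bullet> (x - A *v y)) / s - x \<bullet> u"
    using s by (simp add: inner_diff_left inner_diff_right inner_add_left inner_add_right inner_commute field_simps)
  finally show ?thesis by (simp add: u_def)
qed

lemma nn_integral_lborel_translate:
  fixes f :: "'a::euclidean_space \<Rightarrow> ennreal"
  assumes [measurable]: "f \<in> borel_measurable borel"
  shows "(\<integral>\<^sup>+y. f (y - a) \<partial>lborel) = (\<integral>\<^sup>+y. f y \<partial>lborel)"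
proof -
  have "(\<integral>\<^sup>+y. f y \<partial>lborel) = (\<integral>\<^sup>+y. f y \<partial>distr lborel borel ((+) (- a)))"
    by (simp add: lborel_distr_plus)
  also have "\<dots> = (\<integral>\<^sup>+y. f (y - a) \<partial>lborel)"
    by (subst nn_integral_distr) auto
  finally show ?thesis by simp
qed

text \<open>
  Completing the square shows that the integral equals \<open>J \<rho>(x)\<close> with a constant \<open>J\<close>. Integrating over
  \<open>x\<close> and exchanging the integrals leaves the mass of \<open>\<rho>\<close> unchanged, because every \<open>q(y, \<cdot>)\<close> has mass 1;
  as that mass is finite and positive, \<open>J = 1\<close>.
\<close>

lemma normal_invariant:
  fixes A R :: "real^'n^'n"
  assumes R: "pos_def R" and s: "0 < s"
    and eq: "R = s *\<^sub>R mat 1 + A ** R ** transpose A"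
  shows "(\<integral>\<^sup>+y. ennreal (mv_normal_density 0 R y * mv_normal_density (A *v y) (s *\<^sub>R mat 1) x) \<partial>lborel)
    = ennreal (mv_normal_density 0 R x)"
proof -
  define G where "G = R ** transpose A ** matrix_inv R"
  define Q where "Q = (\<lambda>y. y \<bullet> (matrix_inv R *v y) + ((A *v y) \<bullet> (A *v y)) / s)"
  define k where "k = 1 / sqrt (2 * pi * s) ^ CARD('n)"
  define J where "J = ennreal k * (\<integral>\<^sup>+y. ennreal (exp (- Q y / 2)) \<partial>lborel)"
  define \<rho> where "\<rho> = mv_normal_density 0 R"
  define q where "q x y = mv_normal_density (A *v x) (s *\<^sub>R mat 1) y" for x y
  have \<rho>_pos: "0 < \<rho> x" for x using mv_normal_density_pos[OF R] by (simp add: \<rho>_def)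
  have q_pos: "0 < q x y" for x y
    using mv_normal_density_pos[OF pos_def_scaled_identity[OF s]] by (simp add: q_def)
  have k: "0 \<le> k" using s by (simp add: k_def)
  have [measurable]: "\<rho> \<in> borel_measurable borel" by (simp add: \<rho>_def)
  have qm: "(\<lambda>(x, y). q x y) \<in> borel_measurable (borel \<Otimes>\<^sub>M borel)"
    using mv_normal_density_kernel_measurable[of A "s *\<^sub>R mat 1"] by (simp add: q_def borel_prod)
  then have [measurable]: "(\<lambda>x. q (f x) (g x)) \<in> borel_measurable M"
    if [measurable]: "f \<in> borel_measurable M" "g \<in> borel_measurable M" for f g and M :: "'b measure"
    using measurable_compose[of "\<lambda>x. (f x, g x)" M _ "\<lambda>(x, y). q x y"] by simp
  have [measurable]: "Q \<in> borel_measurable borel"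
    unfolding Q_def by (intro borel_measurable_continuous_onI continuous_intros) (use s in auto)
  have joint: "\<rho> y * q y x = \<rho> x * (k * exp (- Q (y - G *v x) / 2))" for x y
  proof -
    have square: "y \<bullet> (matrix_inv R *v y) + ((x - A *v y) \<bullet> (x - A *v y)) / s
        = x \<bullet> (matrix_inv R *v x) + Q (y - G *v x)"
      unfolding Q_def G_def by (rule complete_square_invariant[OF R s eq])
    have "\<rho> y * q y x
      = k * exp (- (y \<bullet> (matrix_inv R *v y) + ((x - A *v y) \<bullet> (x - A *v y)) / s) / 2)
        / sqrt ((2 * pi) ^ CARD('n) * det R)"
    proof -
      have "exp (- a / 2) * exp (- b / (2 * s)) = exp (- (a + b / s) / 2)" for a b
        unfolding mult_exp_exp using s by (simp add: field_simps)
      from this[symmetric] show ?thesis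
        by (simp only: \<rho>_def q_def k_def mv_normal_density_isotropic[OF s])
          (simp add: mv_normal_density_def)
    qed
    also have "\<dots> = \<rho> x * (k * exp (- Q (y - G *v x) / 2))"
    proof -
      have "exp (- (a + b) / 2) = exp (- a / 2) * exp (- b / 2)" for a b :: real
        unfolding mult_exp_exp by (simp add: field_simps)
      then show ?thesis by (simp only: square) (simp add: \<rho>_def mv_normal_density_def)
    qed
    finally show ?thesis .
  qed
  have proportional: "(\<integral>\<^sup>+y. ennreal (\<rho> y * q y x) \<partial>lborel) = ennreal (\<rho> x) * J" for x
  proof -
    have "(\<integral>\<^sup>+y. ennreal (\<rho> y * q y x) \<partial>lborel)
      = (\<integral>\<^sup>+y. ennreal (\<rho> x * k) * ennreal (exp (- Q (y - G *v x) / 2)) \<partial>lborel)"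
      using \<rho>_pos[of x] k by (intro nn_integral_cong) (simp add: joint ennreal_mult'[symmetric] mult.assoc)
    also have "\<dots> = ennreal (\<rho> x * k) * (\<integral>\<^sup>+y. ennreal (exp (- Q (y - G *v x) / 2)) \<partial>lborel)"
      by (rule nn_integral_cmult) simp
    also have "(\<integral>\<^sup>+y. ennreal (exp (- Q (y - G *v x) / 2)) \<partial>lborel) = (\<integral>\<^sup>+y. ennreal (exp (- Q y / 2)) \<partial>lborel)"
      by (rule nn_integral_lborel_translate) simp
    finally show ?thesis using \<rho>_pos[of x] k by (simp add: J_def ennreal_mult mult.assoc less_imp_le)
  qed
  define I where "I = (\<integral>\<^sup>+x. ennreal (\<rho> x) \<partial>lborel)"
  have I_fin: "I < \<infinity>" using nn_integral_mv_normal_finite[OF R] by (simp add: I_def \<rho>_def)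
  have I_pos: "I \<noteq> 0"
  proof
    assume "I = 0"
    then have "AE x in lborel. ennreal (\<rho> x) = 0" unfolding I_def by (subst (asm) nn_integral_0_iff_AE) auto
    then have "AE x in (lborel :: (real^'n) measure). False"
      by (rule eventually_mono) (metis \<rho>_pos ennreal_eq_0_iff not_le)
    then show False by (simp add: AE_iff_null null_sets_def)
  qed
  have "I * J = (\<integral>\<^sup>+x. \<integral>\<^sup>+y. ennreal (\<rho> y * q y x) \<partial>lborel \<partial>lborel)"
    unfolding proportional I_def by (rule nn_integral_multc[symmetric]) simp
  also have "\<dots> = (\<integral>\<^sup>+y. \<integral>\<^sup>+x. ennreal (\<rho> y * q y x) \<partial>lborel \<partial>lborel)"
    by (rule lborel_pair.Fubini') (simp add: split_beta)
  also have "\<dots> = (\<integral>\<^sup>+y. ennreal (\<rho> y) * (\<integral>\<^sup>+x. ennreal (q y x) \<partial>lborel) \<partial>lborel)"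
    using \<rho>_pos by (subst nn_integral_cmult[symmetric]) (auto simp: ennreal_mult' less_imp_le)
  also have "\<dots> = I"
    by (simp add: q_def nn_integral_isotropic_normal[OF s] I_def)
  finally have "I * J = I * 1" by simp
  then have "J = 1" using I_pos I_fin by (subst (asm) ennreal_mult_cancel_left) auto
  then show ?thesis using proportional[of x] by (simp add: \<rho>_def q_def)
qed

section \<open>Vorticity densities from invariant densities\<close>

text \<open>
  Over \<open>A \<times> UNIV\<close> both terms of the flux have the same finite mass, the integral of \<open>\<rho>\<close> over \<open>A\<close>: the
  first because \<open>q(x, \<cdot>)\<close> is a probability density, the second because \<open>\<rho>\<close> is invariant.
\<close>

lemma invariant_flux:
  fixes q :: "real^'n \<Rightarrow> real^'n \<Rightarrow> real" and \<rho> :: "real^'n \<Rightarrow> real"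
  assumes qm: "(\<lambda>(x, y). q x y) \<in> borel_measurable borel"
    and \<rho>m [measurable]: "\<rho> \<in> borel_measurable borel"
    and q0: "\<And>x y. 0 \<le> q x y" and \<rho>0: "\<And>x. 0 \<le> \<rho> x"
    and q1: "\<And>x. (\<integral>\<^sup>+y. ennreal (q x y) \<partial>lborel) = 1"
    and fin: "(\<integral>\<^sup>+x. ennreal (\<rho> x) \<partial>lborel) < \<infinity>"
    and inv: "\<And>x. (\<integral>\<^sup>+y. ennreal (\<rho> y * q y x) \<partial>lborel) = ennreal (\<rho> x)"
    and A: "A \<in> sets borel"
  defines "\<gamma> \<equiv> \<lambda>(x, y). \<rho> x * q x y - \<rho> y * q y x"
  shows "\<gamma> \<in> borel_measurable borel"
    "set_integrable lborel (A \<times> UNIV) \<gamma>"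
    "set_lebesgue_integral lborel (A \<times> UNIV) \<gamma> = 0"
proof -
  have [measurable]: "(\<lambda>x. q (f x) (g x)) \<in> borel_measurable M"
    if [measurable]: "f \<in> borel_measurable M" "g \<in> borel_measurable M" for f g and M :: "'b measure"
    using measurable_compose[of "\<lambda>x. (f x, g x)" M _ "\<lambda>(x, y). q x y"] qm by (simp add: borel_prod[symmetric])
  define f where "f = (\<lambda>z :: (real^'n) \<times> (real^'n). indicator (A \<times> UNIV) z * (\<rho> (fst z) * q (fst z) (snd z)))"
  define g where "g = (\<lambda>z :: (real^'n) \<times> (real^'n). indicator (A \<times> UNIV) z * (\<rho> (snd z) * q (snd z) (fst z)))"
  have [measurable]: "A \<in> sets borel" by fact
  have [measurable]: "f \<in> borel_measurable (borel \<Otimes>\<^sub>M borel)" "g \<in> borel_measurable (borel \<Otimes>\<^sub>M borel)"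
    unfolding f_def g_def by measurable
  then have fgm [measurable]: "f \<in> borel_measurable borel" "g \<in> borel_measurable borel" by (simp_all add: borel_prod)
  have f0: "0 \<le> f z" and g0: "0 \<le> g z" for z by (simp_all add: f_def g_def q0 \<rho>0)
  define I where "I = (\<integral>\<^sup>+x. ennreal (\<rho> x) * indicator A x \<partial>lborel)"
  have If: "(\<integral>\<^sup>+z. ennreal (f z) \<partial>lborel) = I"
  proof -
    have "(\<integral>\<^sup>+z. ennreal (f z) \<partial>lborel) = (\<integral>\<^sup>+x. \<integral>\<^sup>+y. ennreal (f (x, y)) \<partial>lborel \<partial>lborel)"
      by (subst lborel_prod[symmetric], subst lborel.nn_integral_fst[symmetric]) (auto simp: lborel_prod)
    also have "\<dots> = (\<integral>\<^sup>+x. \<integral>\<^sup>+y. ennreal (\<rho> x) * indicator A x * ennreal (q x y) \<partial>lborel \<partial>lborel)"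
      by (intro nn_integral_cong) (auto simp: f_def ennreal_mult' \<rho>0 indicator_def)
    also have "\<dots> = I"
      by (subst nn_integral_cmult) (auto simp: q1 I_def)
    finally show ?thesis .
  qed
  have Ig: "(\<integral>\<^sup>+z. ennreal (g z) \<partial>lborel) = I"
  proof -
    have "(\<integral>\<^sup>+z. ennreal (g z) \<partial>lborel) = (\<integral>\<^sup>+x. \<integral>\<^sup>+y. ennreal (g (x, y)) \<partial>lborel \<partial>lborel)"
      by (subst lborel_prod[symmetric], subst lborel.nn_integral_fst[symmetric]) (auto simp: lborel_prod)
    also have "\<dots> = (\<integral>\<^sup>+x. \<integral>\<^sup>+y. ennreal (\<rho> y * q y x) * indicator A x \<partial>lborel \<partial>lborel)"
      by (intro nn_integral_cong) (auto simp: g_def indicator_def)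
    also have "\<dots> = I"
      by (subst nn_integral_multc) (auto simp: inv I_def)
    finally show ?thesis .
  qed
  have "I \<le> (\<integral>\<^sup>+x. ennreal (\<rho> x) \<partial>lborel)"
    unfolding I_def by (intro nn_integral_mono) (auto simp: indicator_def)
  then have I: "I < \<infinity>" using fin by (rule order_le_less_trans)
  have int: "integrable lborel f" "integrable lborel g"
    using If Ig I f0 g0 by (auto intro!: integrableI_nonneg fgm)
  have eq: "indicator (A \<times> UNIV) z *\<^sub>R \<gamma> z = f z - g z" for z
    by (simp add: \<gamma>_def f_def g_def split_beta right_diff_distrib)
  show "\<gamma> \<in> borel_measurable borel"
  proof -
    have "\<gamma> \<in> borel_measurable (borel \<Otimes>\<^sub>M borel)"
      unfolding \<gamma>_def split_beta by measurable
    then show ?thesis by (simp add: borel_prod)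
  qed
  show "set_integrable lborel (A \<times> UNIV) \<gamma>"
    unfolding set_integrable_def eq by (intro Bochner_Integration.integrable_diff int)
  have "integral\<^sup>L lborel f = enn2real I" "integral\<^sup>L lborel g = enn2real I"
    using If Ig f0 g0 by (simp_all add: integral_eq_nn_integral fgm)
  then show "set_lebesgue_integral lborel (A \<times> UNIV) \<gamma> = 0"
    unfolding set_lebesgue_integral_def eq by (simp add: int)
qed

section \<open>Comparison of the two Gaussians\<close>

text \<open>
  Let \<open>T = B V B'\<close>. From \<open>A V A' = V - 2 h I + h\<^sup>2 T\<close> and \<open>T \<le> C2 I\<close>, the condition \<open>h C2 < 2\<close> makes \<open>A\<close> a
  contraction for the form of \<open>V\<close>. By the Lyapunov equation for \<open>R\<close>,
    \<^item> \<open>X = R - \<sigma>\<^sup>2 V\<close> satisfies \<open>X - A X A' = \<sigma>\<^sup>2 h\<^sup>2 T \<ge> 0\<close>, and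
    \<^item> \<open>X = V - R\<close> satisfies \<open>X - A X A' = h (2 (1 - \<sigma>\<^sup>2) I - h T)\<close>, which is nonnegative because
      \<open>h T \<le> h C1 I \<le> 2 (1 - \<sigma>\<^sup>2) I\<close>.
  The maximum principle turns both into \<open>X \<ge> 0\<close>.
\<close>

lemma stationary_covariance_bounds:
  fixes V S R :: "real^'n^'n" and h \<sigma> :: real
  defines "A \<equiv> mat 1 + h *\<^sub>R (- ((mat 1 + S) ** matrix_inv V))"
  assumes V: "pos_def V" and S: "transpose S = - S"
    and pos: "0 < h" "0 < \<sigma>"
    and h: "h < 2 / drift_norm_bound V S"
    and \<sigma>: "\<sigma>\<^sup>2 \<le> (2 - h * drift_norm_bound V S) / (2 - h * (drift_norm_bound V S - drift_similar_norm V S))"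
  shows "\<exists>!R. pos_def R \<and> R = (2 * h * \<sigma>\<^sup>2) *\<^sub>R mat 1 + A ** R ** transpose A"
    and "\<And>R x. R = (2 * h * \<sigma>\<^sup>2) *\<^sub>R mat 1 + A ** R ** transpose A
      \<Longrightarrow> \<sigma>\<^sup>2 * (x \<bullet> (V *v x)) \<le> x \<bullet> (R *v x)"
    and "\<And>R x. R = (2 * h * \<sigma>\<^sup>2) *\<^sub>R mat 1 + A ** R ** transpose A
      \<Longrightarrow> x \<bullet> (R *v x) \<le> x \<bullet> (V *v x)"
proof -
  define C1 where "C1 = drift_similar_norm V S"
  define C2 where "C2 = drift_norm_bound V S"
  define T where "T = drift_covariance V S"
  note C = drift_similar_norm_pos[OF V S, folded C1_def] drift_similar_norm_le_bound[OF V S, folded C1_def C2_def]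
  have T_le: "x \<bullet> (T *v x) \<le> C1 * (x \<bullet> x)" for x
    using drift_covariance_le[OF V S] by (simp add: T_def C1_def)
  have T_ge: "0 \<le> x \<bullet> (T *v x)" for x
    using pos_defD(3)[OF pos_def_drift_covariance[OF V S]] by (simp add: T_def)
  have hC2: "h * C2 < 2" using h C by (simp add: C2_def[symmetric] pos_less_divide_eq)
  have step: "(transpose A *v x) \<bullet> (V *v (transpose A *v x))
      = x \<bullet> (V *v x) - 2 * h * (x \<bullet> x) + h\<^sup>2 * (x \<bullet> (T *v x))" for x
    using transition_form[OF V S, of h x] by (simp only: A_def T_def)
  have contr: "(transpose A *v x) \<bullet> (V *v (transpose A *v x)) < x \<bullet> (V *v x)" if "x \<noteq> 0" for x
  proof -
    have xx: "0 < x \<bullet> x" using that by simp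
    have "h * (h * (x \<bullet> (T *v x))) \<le> h * (h * (C2 * (x \<bullet> x)))"
      using T_le[of x] mult_right_mono[OF C(2) inner_ge_zero[of x]] pos
      by (intro mult_left_mono) auto
    also have "\<dots> = h * ((h * C2) * (x \<bullet> x))" by simp
    also have "\<dots> < h * (2 * (x \<bullet> x))"
      using hC2 xx pos by (intro mult_strict_left_mono mult_strict_right_mono)
    finally show ?thesis unfolding step by (simp add: power2_eq_square mult_ac)
  qed
  \<comment> \<open>The bound on \<open>\<sigma>\<close> reads \<open>h C1 \<le> (1 - \<sigma>\<^sup>2) D\<close> with \<open>D \<le> 2\<close>, because \<open>C1 \<le> C2\<close>.\<close>
  have hC1: "h * C1 \<le> 2 * (1 - \<sigma>\<^sup>2)"
  proof -
    define D where "D = 2 - h * (C2 - C1)"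
    have D: "D = 2 - h * C2 + h * C1" by (simp add: D_def algebra_simps)
    have hc: "0 < h * C1" "h * C1 \<le> h * C2" using pos C by auto
    then have D0: "0 < D" "D \<le> 2" using hC2 by (simp_all add: D)
    have "\<sigma>\<^sup>2 * D \<le> 2 - h * C2"
      using \<sigma> D0 by (simp add: C1_def[symmetric] C2_def[symmetric] D_def[symmetric] pos_le_divide_eq)
    then have le: "h * C1 \<le> (1 - \<sigma>\<^sup>2) * D" by (simp add: D algebra_simps)
    then have "0 < (1 - \<sigma>\<^sup>2) * D" using hc by linarith
    then have "0 \<le> 1 - \<sigma>\<^sup>2" using D0 by (simp add: zero_less_mult_iff)
    then have "(1 - \<sigma>\<^sup>2) * D \<le> (1 - \<sigma>\<^sup>2) * 2" using D0 by (intro mult_left_mono)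
    with le show ?thesis by simp
  qed
  have R_step: "x \<bullet> (R *v x) = 2 * h * \<sigma>\<^sup>2 * (x \<bullet> x) + (transpose A *v x) \<bullet> (R *v (transpose A *v x))"
    if "R = (2 * h * \<sigma>\<^sup>2) *\<^sub>R mat 1 + A ** R ** transpose A" for R x
  proof -
    have "R *v x = (2 * h * \<sigma>\<^sup>2) *\<^sub>R x + A ** R ** transpose A *v x"
      by (subst that) (simp only: matrix_vector_mult_add_rdistrib scaleR_matrix_vector_assoc[symmetric] matrix_vector_mul_lid)
    then show ?thesis by (simp only: inner_add_right inner_scaleR_right inner_congruence)
  qed
  have diff: "x \<bullet> ((a *\<^sub>R M - b *\<^sub>R N) *v x) = a * (x \<bullet> (M *v x)) - b * (x \<bullet> (N *v x))"
    for a b and M N :: "real^'n^'n" and x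
    by (simp add: matrix_vector_mult_diff_rdistrib scaleR_matrix_vector_assoc[symmetric] inner_diff_right)
  have lower: "\<sigma>\<^sup>2 * (x \<bullet> (V *v x)) \<le> x \<bullet> (R *v x)"
    if R: "R = (2 * h * \<sigma>\<^sup>2) *\<^sub>R mat 1 + A ** R ** transpose A" for R x
  proof -
    have "0 \<le> x \<bullet> ((1 *\<^sub>R R - \<sigma>\<^sup>2 *\<^sub>R V) *v x)"
    proof (rule Lyapunov_nonneg[OF V contr])
      fix x :: "real^'n"
      have "0 \<le> \<sigma>\<^sup>2 * (h\<^sup>2 * (x \<bullet> (T *v x)))" using T_ge[of x] by simp
      then show "(transpose A *v x) \<bullet> ((1 *\<^sub>R R - \<sigma>\<^sup>2 *\<^sub>R V) *v (transpose A *v x))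
          \<le> x \<bullet> ((1 *\<^sub>R R - \<sigma>\<^sup>2 *\<^sub>R V) *v x)"
        unfolding diff step R_step[OF R, of x] by (simp only: algebra_simps)
    qed
    then show ?thesis by (simp only: diff)
  qed
  have upper: "x \<bullet> (R *v x) \<le> x \<bullet> (V *v x)"
    if R: "R = (2 * h * \<sigma>\<^sup>2) *\<^sub>R mat 1 + A ** R ** transpose A" for R x
  proof -
    have "0 \<le> x \<bullet> ((1 *\<^sub>R V - 1 *\<^sub>R R) *v x)"
    proof (rule Lyapunov_nonneg[OF V contr])
      fix x :: "real^'n"
      have "h * (x \<bullet> (T *v x)) \<le> h * (C1 * (x \<bullet> x))" using T_le[of x] pos by simp
      also have "\<dots> \<le> 2 * (1 - \<sigma>\<^sup>2) * (x \<bullet> x)"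
        using mult_right_mono[OF hC1 inner_ge_zero[of x]] by (simp add: mult_ac)
      finally have "h * (h * (x \<bullet> (T *v x))) \<le> h * (2 * (1 - \<sigma>\<^sup>2) * (x \<bullet> x))"
        using pos by (intro mult_left_mono) auto
      then show "(transpose A *v x) \<bullet> ((1 *\<^sub>R V - 1 *\<^sub>R R) *v (transpose A *v x))
          \<le> x \<bullet> ((1 *\<^sub>R V - 1 *\<^sub>R R) *v x)"
        unfolding diff step R_step[OF R, of x] by (simp only: algebra_simps power2_eq_square)
    qed
    then show ?thesis by (simp only: diff)
  qed
  have sym_noise: "transpose ((2 * h * \<sigma>\<^sup>2) *\<^sub>R mat 1 :: real^'n^'n) = (2 * h * \<sigma>\<^sup>2) *\<^sub>R mat 1"
    by (simp only: transpose_scalar transpose_mat)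
  have "\<exists>!R. transpose R = R \<and> R = (2 * h * \<sigma>\<^sup>2) *\<^sub>R mat 1 + A ** R ** transpose A"
    by (rule Lyapunov_ex1[OF V contr sym_noise])
  then obtain R where R: "transpose R = R" "R = (2 * h * \<sigma>\<^sup>2) *\<^sub>R mat 1 + A ** R ** transpose A"
    and unique: "\<And>X. transpose X = X \<and> X = (2 * h * \<sigma>\<^sup>2) *\<^sub>R mat 1 + A ** X ** transpose A \<Longrightarrow> X = R"
    by (elim ex1E conjE) blast
  show "\<exists>!R. pos_def R \<and> R = (2 * h * \<sigma>\<^sup>2) *\<^sub>R mat 1 + A ** R ** transpose A"
  proof (rule ex1I[of _ R])
    have "0 < x \<bullet> (R *v x)" if "x \<noteq> 0" for x
      using lower[OF R(2), of x] pos_defD(2)[OF V that] pos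
      by (meson mult_pos_pos order_less_le_trans zero_less_power)
    then show "pos_def R \<and> R = (2 * h * \<sigma>\<^sup>2) *\<^sub>R mat 1 + A ** R ** transpose A"
      unfolding pos_def_def using R by blast
  qed (use unique pos_defD(1) in blast)
  show "\<sigma>\<^sup>2 * (x \<bullet> (V *v x)) \<le> x \<bullet> (R *v x)" if "R = (2 * h * \<sigma>\<^sup>2) *\<^sub>R mat 1 + A ** R ** transpose A" for R x
    by (rule lower[OF that])
  show "x \<bullet> (R *v x) \<le> x \<bullet> (V *v x)" if "R = (2 * h * \<sigma>\<^sup>2) *\<^sub>R mat 1 + A ** R ** transpose A" for R x
    by (rule upper[OF that])
qed

text \<open>
  \<open>R \<le> V\<close> compares the exponents, and \<open>\<sigma>\<^sup>2 V \<le> R\<close> compares the normalizing constants: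
  \<open>det R \<ge> \<sigma>\<^sup>2\<^sup>n det V\<close>, so a factor of at most \<open>\<sigma>\<^sup>n\<close> compensates for the larger peak of the narrower
  Gaussian.
\<close>

lemma normal_density_domination:
  fixes V R :: "real^'n^'n"
  assumes V: "pos_def V" and R: "pos_def R" and pos: "0 < \<sigma>" "0 < c" and c: "c \<le> \<sigma> ^ CARD('n)"
    and lower: "\<And>x. \<sigma>\<^sup>2 * (x \<bullet> (V *v x)) \<le> x \<bullet> (R *v x)"
    and upper: "\<And>x. x \<bullet> (R *v x) \<le> x \<bullet> (V *v x)"
  shows "c * mv_normal_density 0 R x \<le> mv_normal_density 0 V x"
proof -
  have V': "pos_def (\<sigma>\<^sup>2 *\<^sub>R V)"
    using V pos by (simp add: pos_def_def transpose_scalar scaleR_matrix_vector_assoc[symmetric])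
  have "\<sigma>\<^sup>2 *\<^sub>R V = (\<sigma>\<^sup>2 *\<^sub>R mat 1) ** V" by (simp add: scalar_matrix_assoc[symmetric])
  moreover have "det (\<sigma>\<^sup>2 *\<^sub>R mat 1 :: real^'n^'n) = (\<sigma>\<^sup>2) ^ CARD('n)"
    by (subst det_diagonal) (auto simp: mat_def)
  ultimately have "det (\<sigma>\<^sup>2 *\<^sub>R V) = (\<sigma> ^ CARD('n))\<^sup>2 * det V"
    by (simp add: det_mul power_mult[symmetric] mult.commute)
  moreover have "det (\<sigma>\<^sup>2 *\<^sub>R V) \<le> det R"
    using lower by (intro det_mono V' pos_defD(1)[OF R]) (simp add: scaleR_matrix_vector_assoc[symmetric])
  ultimately have "(\<sigma> ^ CARD('n))\<^sup>2 * det V \<le> det R" by simp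
  moreover have "c\<^sup>2 * det V \<le> (\<sigma> ^ CARD('n))\<^sup>2 * det V"
    using c pos det_pos_def_pos[OF V] by (intro mult_right_mono power_mono) auto
  ultimately have det: "c\<^sup>2 * det V \<le> det R" by simp
  define K where "K = (2 * pi) ^ CARD('n)"
  have K: "0 < K" by (simp add: K_def)
  have "c * sqrt (K * det V) = sqrt (K * (c\<^sup>2 * det V))"
    using pos by (simp add: real_sqrt_mult)
  also have "\<dots> \<le> sqrt (K * det R)" using det K by simp
  finally have sq: "c * sqrt (K * det V) \<le> sqrt (K * det R)" .
  have pV: "0 < sqrt (K * det V)" and pR: "0 < sqrt (K * det R)"
    using K det_pos_def_pos[OF V] det_pos_def_pos[OF R] by auto
  have "c / sqrt (K * det R) \<le> 1 / sqrt (K * det V)"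
    using sq pV pR by (simp add: divide_le_eq le_divide_eq mult.commute)
  moreover have "exp (- (x \<bullet> (matrix_inv R *v x)) / 2) \<le> exp (- (x \<bullet> (matrix_inv V *v x)) / 2)"
    using matrix_inv_antimono[OF R V upper, of x] by simp
  ultimately have "exp (- (x \<bullet> (matrix_inv R *v x)) / 2) * (c / sqrt (K * det R))
      \<le> exp (- (x \<bullet> (matrix_inv V *v x)) / 2) * (1 / sqrt (K * det V))"
    using pos pR by (intro mult_mono) auto
  then show ?thesis by (simp add: mv_normal_density_def K_def mult.commute)
qed

theorem theorem4p2:
  fixes V S B R :: "real^'n^'n"
    and C1 C2 c h \<sigma> :: real
    and p \<rho> :: "real^'n \<Rightarrow> real"
    and q \<gamma> :: "real^'n \<Rightarrow> real^'n \<Rightarrow> real"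
  assumes V: "pos_def V"
    and S: "transpose S = - S"
    and B: "B = - ((mat 1 + S) ** matrix_inv V)"
    and C1: "C1 = matrix_norm (matrix_inv (matrix_sqrt V) ** (mat 1 + S) ** matrix_inv V
                     ** (mat 1 - S) ** matrix_sqrt V)"
    and C2: "C2 = (matrix_norm (matrix_inv (matrix_sqrt V) ** (mat 1 + S)
                     ** matrix_inv (matrix_sqrt V)))\<^sup>2 * matrix_norm V"
    and pos: "c > 0" "h > 0" "\<sigma> > 0"
    and h: "h < 2 / C2"
    and \<sigma>: "\<sigma>\<^sup>2 \<le> (2 - h * C2) / (2 - h * (C2 - C1))"
    and c: "c \<le> \<sigma> ^ CARD('n)"
    and p: "\<And>x. p x = mv_normal_density 0 V x"
    and q: "\<And>x y. q x y = mv_normal_density ((mat 1 + h *\<^sub>R B) *v x) ((2 * h * \<sigma>\<^sup>2) *\<^sub>R mat 1) y"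
    and R: "R = (THE R. pos_def R \<and>
                   R = (2 * h * \<sigma>\<^sup>2) *\<^sub>R mat 1
                       + (mat 1 + h *\<^sub>R B) ** R ** (mat 1 + h *\<^sub>R transpose B))"
    and \<rho>: "\<And>x. \<rho> x = mv_normal_density 0 R x"
    and \<gamma>: "\<And>x y. \<gamma> x y = \<rho> x * q x y - \<rho> y * q y x"
  shows "0 < C1 \<and> C1 \<le> C2 \<and>
    (\<exists>!R. pos_def R \<and>
       R = (2 * h * \<sigma>\<^sup>2) *\<^sub>R mat 1
           + (mat 1 + h *\<^sub>R B) ** R ** (mat 1 + h *\<^sub>R transpose B)) \<and>
    (\<forall>x y. c * \<gamma> x y + p y * q y x \<ge> 0) \<and>
    vorticity_density q p (\<lambda>x y. c * \<gamma> x y)"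
proof -
  define A where "A = mat 1 + h *\<^sub>R B"
  define s where "s = 2 * h * \<sigma>\<^sup>2"
  have s: "0 < s" using pos by (simp add: s_def)
  have At: "mat 1 + h *\<^sub>R transpose B = transpose A"
    by (simp add: A_def transpose_add transpose_scalar)
  have C1': "C1 = drift_similar_norm V S" using C1 by (simp add: drift_similar_norm_def)
  have C2': "C2 = drift_norm_bound V S" using C2 by (simp add: drift_norm_bound_def)
  note bounds = stationary_covariance_bounds[OF V S pos(2,3) h[unfolded C2'] \<sigma>[unfolded C1' C2'],
      folded B, folded A_def s_def]
  have RR: "pos_def R \<and> R = s *\<^sub>R mat 1 + A ** R ** transpose A"
    unfolding R At s_def[symmetric] A_def[symmetric] by (rule theI'[OF bounds(1)])
  then have Rpos: "pos_def R" and Req: "R = s *\<^sub>R mat 1 + A ** R ** transpose A" by blast+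
  have dom: "c * \<rho> x \<le> p x" for x
    unfolding \<rho> p
    by (rule normal_density_domination[OF V Rpos pos(3,1) c bounds(2,3)[OF Req]])
  have q': "q x y = mv_normal_density (A *v x) (s *\<^sub>R mat 1) y" for x y
    by (simp only: q A_def s_def)
  have p_pos: "0 < p x" and \<rho>_pos: "0 < \<rho> x" and q_pos: "0 < q x y" for x y
    by (simp_all only: p \<rho> q' mv_normal_density_pos V Rpos pos_def_scaled_identity[OF s])
  have nonneg: "0 \<le> c * \<gamma> x y + p y * q y x" for x y
  proof -
    have "0 \<le> c * (\<rho> x * q x y)" using pos \<rho>_pos[of x] q_pos[of x y] by simp
    moreover have "c * \<rho> y * q y x \<le> p y * q y x"
      using dom[of y] q_pos[of y x] by (intro mult_right_mono) auto
    ultimately show ?thesis by (simp add: \<gamma> algebra_simps)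
  qed
  have \<gamma>': "(\<lambda>(x, y). c * \<gamma> x y) = (\<lambda>z. c * (\<lambda>(x, y). \<rho> x * q x y - \<rho> y * q y x) z)"
    by (auto simp: \<gamma>)
  have flux: "(\<lambda>(x, y). \<rho> x * q x y - \<rho> y * q y x) \<in> borel_measurable borel"
    "set_integrable lborel (E \<times> UNIV) (\<lambda>(x, y). \<rho> x * q x y - \<rho> y * q y x)"
    "set_lebesgue_integral lborel (E \<times> UNIV) (\<lambda>(x, y). \<rho> x * q x y - \<rho> y * q y x) = 0"
    if "E \<in> sets borel" for E
  proof -
    have a: "(\<lambda>(x, y). q x y) \<in> borel_measurable borel" "\<rho> \<in> borel_measurable borel"
      unfolding q' using mv_normal_density_kernel_measurable[of A "s *\<^sub>R mat 1"]
        mv_normal_density_measurable[of 0 R] by (simp_all add: \<rho>[abs_def])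
    have b: "(\<integral>\<^sup>+y. ennreal (q x y) \<partial>lborel) = 1" for x
      unfolding q' by (rule nn_integral_isotropic_normal[OF s])
    have d: "(\<integral>\<^sup>+x. ennreal (\<rho> x) \<partial>lborel) < \<infinity>"
      unfolding \<rho> by (rule nn_integral_mv_normal_finite[OF Rpos])
    have e: "(\<integral>\<^sup>+y. ennreal (\<rho> y * q y x) \<partial>lborel) = ennreal (\<rho> x)" for x
      unfolding \<rho> q' by (rule normal_invariant[OF Rpos s Req])
    note f = invariant_flux[OF a less_imp_le[OF q_pos] less_imp_le[OF \<rho>_pos] b d e that]
    show "(\<lambda>(x, y). \<rho> x * q x y - \<rho> y * q y x) \<in> borel_measurable borel"
      "set_integrable lborel (E \<times> UNIV) (\<lambda>(x, y). \<rho> x * q x y - \<rho> y * q y x)"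
      "set_lebesgue_integral lborel (E \<times> UNIV) (\<lambda>(x, y). \<rho> x * q x y - \<rho> y * q y x) = 0"
      by (rule f)+
  qed
  have "vorticity_density q p (\<lambda>x y. c * \<gamma> x y)"
    unfolding vorticity_density_def \<gamma>'
  proof (intro conjI allI ballI impI)
    show "(\<lambda>z. c * (\<lambda>(x, y). \<rho> x * q x y - \<rho> y * q y x) z) \<in> borel_measurable borel"
      by (intro borel_measurable_times borel_measurable_const flux(1)[of UNIV]) simp
    show "c * \<gamma> x y = - (c * \<gamma> y x)" for x y by (simp add: \<gamma> algebra_simps)
    show "set_integrable lborel (E \<times> UNIV) (\<lambda>z. c * (\<lambda>(x, y). \<rho> x * q x y - \<rho> y * q y x) z)"
      "set_lebesgue_integral lborel (E \<times> UNIV) (\<lambda>z. c * (\<lambda>(x, y). \<rho> x * q x y - \<rho> y * q y x) z) = 0"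
      if "E \<in> sets borel" for E
      using flux(2,3)[OF that] by (simp_all only: set_integrable_mult_right set_integral_mult_right mult_zero_right)
    have nz: "p x * q x y \<noteq> 0" for x y using p_pos[of x] q_pos[of x y] by simp
    show "c * \<gamma> x y = 0" if "p x * q x y = 0" for x y using that nz by blast
    show "p x * q x y = 0 \<longleftrightarrow> p y * q y x = 0" for x y using nz by blast
    show "0 \<le> c * \<gamma> x y + p y * q y x" for x y by (rule nonneg)
  qed
  moreover have "\<exists>!R. pos_def R \<and> R = s *\<^sub>R mat 1 + A ** R ** transpose A" by (rule bounds(1))
  ultimately show ?thesis
    using drift_similar_norm_pos[OF V S] drift_similar_norm_le_bound[OF V S] nonneg
    by (simp only: C1' C2' At s_def[symmetric] A_def[symmetric]) blast
qed

end
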